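(* Let $n\ge 1$, $\mathbf{x}\in[0,1]^n$, $G\in\mathbb{R}^{n\times n}$, $\delta=\epsilon\,\mathbf{1}^\top\mathbf{x}>0$, and let $C\in\mathbb{R}^{n\times n}$ be a cost matrix with nonnegative entries and $C_{ij}=0\Leftrightarrow i=j$. Let $\Pi^\star$ be the solution of the primal problem $$\min_{\Pi\in\mathbb{R}^{n\times n},\,\Pi\ge 0}\ \tfrac12\|\Pi-G\|_{\mathrm F}^2\quad\text{subject to}\quad \Pi\mathbf{1}=\mathbf{x},\ \ \langle\Pi,C\rangle\le\delta,$$ and let $\lambda^\star$ be a solution of its dual problem $\max_{\lambda\ge0}g(\lambda)$, where $$g(\lambda)=\min_{\Pi\mathbf{1}=\mathbf{x},\ \Pi\ge 0}\ \tfrac12\|\Pi-G\|_{\mathrm F}^2+\lambda\big(\langle\Pi,C\rangle-\delta\big).$$ Then $$\Pi^\star=\operatorname*{argmin}_{\Pi\mathbf{1}=\mathbf{x},\ \Pi\ge0}\ \|\Pi-G+\lambda^\star C\|_{\mathrm F}^2,$$ and thus $\Pi^\star$ can be computed in $O(n^2\log n)$ time given $\lambda^\star$.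
   Context: $\mathbf{1}\in\mathbb{R}^n$ is the all-ones vector; $\Pi\ge0$ is entrywise; $\langle A,B\rangle=\sum_{i,j}A_{ij}B_{ij}$; $\|\cdot\|_{\mathrm F}$ is the Frobenius norm. Running time counts exact real arithmetic operations and comparisons. $\epsilon>0$ is a scalar. *)

theory Defs
  imports
    Complex_Main
    "HOL-Library.Landau_Symbols"
    "Jordan_Normal_Form.Matrix"
begin

section \<open>The projection problem and its dual\<close>

definition ones :: "nat \<Rightarrow> real vec" where
  "ones n = vec n (\<lambda>_. 1)"

definition mat_inner :: "real mat \<Rightarrow> real mat \<Rightarrow> real" where
  "mat_inner A B = (\<Sum>i<dim_row A. \<Sum>j<dim_col A. A $$ (i, j) * B $$ (i, j))"

definition frob_norm :: "real mat \<Rightarrow> real" where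
  "frob_norm A = sqrt (\<Sum>i<dim_row A. \<Sum>j<dim_col A. (A $$ (i, j))\<^sup>2)"

definition plans :: "nat \<Rightarrow> real vec \<Rightarrow> real mat set" where
  "plans n x = {P \<in> carrier_mat n n. (\<forall>i<n. \<forall>j<n. 0 \<le> P $$ (i, j)) \<and> P *\<^sub>v ones n = x}"

definition problem_data ::
  "nat \<Rightarrow> real vec \<Rightarrow> real mat \<Rightarrow> real mat \<Rightarrow> real \<Rightarrow> real \<Rightarrow> bool" where
  "problem_data n x G C \<epsilon> \<delta> \<longleftrightarrow>
     1 \<le> n \<and>
     x \<in> carrier_vec n \<and> (\<forall>i<n. 0 \<le> x $ i \<and> x $ i \<le> 1) \<and>
     G \<in> carrier_mat n n \<and>
     C \<in> carrier_mat n n \<and>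
     (\<forall>i<n. \<forall>j<n. 0 \<le> C $$ (i, j) \<and> (C $$ (i, j) = 0 \<longleftrightarrow> i = j)) \<and>
     0 < \<epsilon> \<and> \<delta> = \<epsilon> * (ones n \<bullet> x) \<and> 0 < \<delta>"

definition primal_solution ::
  "nat \<Rightarrow> real vec \<Rightarrow> real mat \<Rightarrow> real mat \<Rightarrow> real \<Rightarrow> real mat \<Rightarrow> bool" where
  "primal_solution n x G C \<delta> =
     is_arg_min (\<lambda>P. 1/2 * (frob_norm (P - G))\<^sup>2)
       (\<lambda>P. P \<in> plans n x \<and> mat_inner P C \<le> \<delta>)"

text \<open>
  For \<open>x \<ge> 0\<close> the set \<open>plans n x\<close> is nonempty and compact, so the infimum below is attained.
\<close>
definition dual_fun ::
  "nat \<Rightarrow> real vec \<Rightarrow> real mat \<Rightarrow> real mat \<Rightarrow> real \<Rightarrow> real \<Rightarrow> real" where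
  "dual_fun n x G C \<delta> l =
     (INF P\<in>plans n x. 1/2 * (frob_norm (P - G))\<^sup>2 + l * (mat_inner P C - \<delta>))"

definition dual_solution ::
  "nat \<Rightarrow> real vec \<Rightarrow> real mat \<Rightarrow> real mat \<Rightarrow> real \<Rightarrow> real \<Rightarrow> bool" where
  "dual_solution n x G C \<delta> = is_arg_max (dual_fun n x G C \<delta>) (\<lambda>l. 0 \<le> l)"


section \<open>A real random-access machine\<close>

text \<open>
  A program is one finite piece of syntax, independent of \<open>n\<close>. It works on natural-number
  index registers and on real arrays; \<open>Cell a r\<close> denotes the entry of array \<open>a\<close>
  whose position is the current content of index register \<open>r\<close>. Real values influence the
  control flow and the index registers only through comparisons, and the only real constants
  are integers. Division by zero is undefined: execution gets stuck.

  Every executed instruction and every evaluated test costs one unit. The cost thus bounds the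
  number of real arithmetic operations and comparisons, and charges index bookkeeping and data
  movement as well.
\<close>

datatype cell = Cell nat nat

datatype real_op = Add | Sub | Mul | Div

datatype instr =
    ISet nat nat
  | IAdd nat nat nat
  | ISub nat nat nat
  | RSet cell int
  | RCopy cell cell
  | ROp real_op cell cell cell

datatype test =
    ILess nat nat
  | RLess cell cell

datatype prog =
    Skip
  | Do instr
  | Seq prog prog
  | If test prog prog
  | While test prog

record machine =
  reg :: "nat \<Rightarrow> nat"
  arr :: "nat \<Rightarrow> nat \<Rightarrow> real"

fun get :: "machine \<Rightarrow> cell \<Rightarrow> real" where
  "get s (Cell a r) = arr s a (reg s r)"

fun put :: "cell \<Rightarrow> real \<Rightarrow> machine \<Rightarrow> machine" where
  "put (Cell a r) v s = s\<lparr>arr := (arr s)(a := (arr s a)(reg s r := v))\<rparr>"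

fun apply_op :: "real_op \<Rightarrow> real \<Rightarrow> real \<Rightarrow> real option" where
  "apply_op Add u v = Some (u + v)"
| "apply_op Sub u v = Some (u - v)"
| "apply_op Mul u v = Some (u * v)"
| "apply_op Div u v = (if v = 0 then None else Some (u / v))"

text \<open>In the instructions, the first operand is the destination; index subtraction is truncated.\<close>

fun step :: "instr \<Rightarrow> machine \<Rightarrow> machine option" where
  "step (ISet r k) s = Some (s\<lparr>reg := (reg s)(r := k)\<rparr>)"
| "step (IAdd r p q) s = Some (s\<lparr>reg := (reg s)(r := reg s p + reg s q)\<rparr>)"
| "step (ISub r p q) s = Some (s\<lparr>reg := (reg s)(r := reg s p - reg s q)\<rparr>)"
| "step (RSet d k) s = Some (put d (of_int k) s)"
| "step (RCopy d u) s = Some (put d (get s u) s)"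
| "step (ROp f d u v) s = map_option (\<lambda>w. put d w s) (apply_op f (get s u) (get s v))"

fun holds :: "test \<Rightarrow> machine \<Rightarrow> bool" where
  "holds (ILess p q) s \<longleftrightarrow> reg s p < reg s q"
| "holds (RLess u v) s \<longleftrightarrow> get s u < get s v"

text \<open>\<open>exec c s t s'\<close>: started in \<open>s\<close>, program \<open>c\<close> halts in \<open>s'\<close> after \<open>t\<close> steps.\<close>

inductive exec :: "prog \<Rightarrow> machine \<Rightarrow> nat \<Rightarrow> machine \<Rightarrow> bool" where
  Skip: "exec Skip s 1 s"
| Do: "step i s = Some s' \<Longrightarrow> exec (Do i) s 1 s'"
| Seq: "exec c s t s' \<Longrightarrow> exec d s' u s'' \<Longrightarrow> exec (Seq c d) s (t + u) s''"
| IfTrue: "holds b s \<Longrightarrow> exec c s t s' \<Longrightarrow> exec (If b c d) s (t + 1) s'"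
| IfFalse: "\<not> holds b s \<Longrightarrow> exec d s t s' \<Longrightarrow> exec (If b c d) s (t + 1) s'"
| WhileFalse: "\<not> holds b s \<Longrightarrow> exec (While b c) s 1 s"
| WhileTrue: "holds b s \<Longrightarrow> exec c s t s' \<Longrightarrow> exec (While b c) s' u s''
    \<Longrightarrow> exec (While b c) s (t + u + 1) s''"

lemma exec_deterministic:
  assumes "exec c s t s'" and "exec c s u s''"
  shows "t = u \<and> s' = s''"
  using assms
proof (induction arbitrary: u s'' rule: exec.induct)
  case (Skip s)
  from Skip.prems show ?case by cases simp
next
  case (Do i s s')
  note i = Do.hyps
  from Do.prems show ?case by cases (simp add: i)
next
  case (Seq c s t s' d u0 s0)
  note IH = Seq.IH
  from Seq.prems show ?case by cases (blast dest: IH)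
next
  case (IfTrue b s c t s' d)
  note b = IfTrue.hyps(1) and IH = IfTrue.IH
  from IfTrue.prems show ?case by cases (use b in \<open>blast dest: IH\<close>)+
next
  case (IfFalse b s d t s' c)
  note b = IfFalse.hyps(1) and IH = IfFalse.IH
  from IfFalse.prems show ?case by cases (use b in \<open>blast dest: IH\<close>)+
next
  case (WhileFalse b s c)
  note b = WhileFalse.hyps
  from WhileFalse.prems show ?case by cases (use b in simp_all)
next
  case (WhileTrue b s c t s' u0 s0)
  note b = WhileTrue.hyps(1) and IH = WhileTrue.IH
  from WhileTrue.prems show ?case by cases (use b in \<open>blast dest: IH\<close>)+
qed

text \<open>
  Inputs: \<open>n\<close> in index register \<open>0\<close>; arrays \<open>0\<close> and \<open>1\<close> hold \<open>G\<close> and \<open>C\<close> in row-major order,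
  array \<open>2\<close> holds \<open>x\<close>, array \<open>3\<close> holds \<open>\<epsilon>\<close> and \<open>\<lambda>\<close>; everything else is \<open>0\<close>. The output matrix
  is read in row-major order from array \<open>4\<close>.
\<close>

definition load ::
  "nat \<Rightarrow> real vec \<Rightarrow> real mat \<Rightarrow> real mat \<Rightarrow> real \<Rightarrow> real \<Rightarrow> machine" where
  "load n x G C \<epsilon> l =
     \<lparr>reg = (\<lambda>_. 0)(0 := n),
      arr = (\<lambda>_ _. 0)
        (0 := (\<lambda>k. if k < n * n then G $$ (k div n, k mod n) else 0),
         1 := (\<lambda>k. if k < n * n then C $$ (k div n, k mod n) else 0),
         2 := (\<lambda>k. if k < n then x $ k else 0),
         3 := (\<lambda>_. 0)(0 := \<epsilon>, 1 := l))\<rparr>"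

definition result :: "nat \<Rightarrow> machine \<Rightarrow> real mat" where
  "result n s = mat n n (\<lambda>(i, j). arr s 4 (i * n + j))"

end

theory Submission
  imports Defs "HOL-Combinatorics.Permutations" "HOL-Real_Asymp.Real_Asymp"
begin

text \<open>
  The diagonal plan with row sums \<open>x\<close> has cost \<open>0 < \<delta>\<close>, so Slater's condition gives a multiplier
  with zero duality gap. Hence the gap also vanishes at \<open>\<lambda>\<^sup>\<star>\<close>, so the primal solution minimizes
  the Lagrangian at \<open>\<lambda>\<^sup>\<star>\<close>. Completing the square, this Lagrangian differs from
  \<open>1/2 \<parallel>\<Pi> - G + \<lambda>\<^sup>\<star> C\<parallel>\<^sup>2\<close> by a constant, and the minimizer of the latter is unique by strict
  convexity.

  The resulting problem splits into the rows \<open>v\<close> of \<open>G - \<lambda>\<^sup>\<star> C\<close>. The projection of \<open>v\<close> onto the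
  nonnegative vectors with sum \<open>a\<close> is \<open>max (v - \<tau>) 0\<close>, where \<open>\<tau>\<close> is the maximum over \<open>k\<close> of
  \<open>(S k - a) / k\<close> and \<open>S k\<close> is the sum of the \<open>k\<close> largest entries of \<open>v\<close>. After a heapsort of each
  row, \<open>\<tau>\<close> is found in a linear scan.
\<close>

section \<open>Lagrangian duality\<close>

text \<open>
  The multiplier is the supremum of the slopes \<open>(p - f Q) / h Q\<close> over the infeasible \<open>Q\<close>. Each is
  at most \<open>(f P - p) / (- h P)\<close> for strictly feasible \<open>P\<close>, because some convex combination of
  \<open>P\<close> and \<open>Q\<close> is feasible.
\<close>

lemma lagrange_multiplier:
  fixes f h :: "'a \<Rightarrow> real"
  assumes conv: "\<And>P Q t. P \<in> S \<Longrightarrow> Q \<in> S \<Longrightarrow> 0 \<le> t \<Longrightarrow> t \<le> 1 \<Longrightarrow>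
      \<exists>R\<in>S. f R \<le> (1 - t) * f P + t * f Q \<and> h R \<le> (1 - t) * h P + t * h Q"
    and slater: "P0 \<in> S" "h P0 < 0"
    and opt: "\<And>P. P \<in> S \<Longrightarrow> h P \<le> 0 \<Longrightarrow> p \<le> f P"
  shows "\<exists>l\<ge>0. \<forall>P\<in>S. p \<le> f P + l * h P"
proof -
  \<comment> \<open>Inserting \<open>0\<close> makes the supremum exist and be nonnegative even if
    no point of \<open>S\<close> is infeasible.\<close>
  let ?A = "insert 0 ((\<lambda>Q. (p - f Q) / h Q) ` {Q \<in> S. 0 < h Q})"
  have key: "a \<le> (f P - p) / (- h P)" if P: "P \<in> S" "h P < 0" and a: "a \<in> ?A" for P a
  proof -
    consider "a = 0" | Q where "Q \<in> S" "0 < h Q" "a = (p - f Q) / h Q" using a by blast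
    then show ?thesis
    proof cases
      case 1
      then show ?thesis using divide_nonneg_pos[of "f P - p" "- h P"] opt[of P] P by simp
    next
      case 2
      define D where "D = h Q - h P"
      have D: "0 < D" using P(2) 2(2) by (simp add: D_def)
      \<comment> \<open>At the weight \<open>- h P / D\<close> the interpolation of
        \<open>h P\<close> and \<open>h Q\<close> is \<open>0\<close>, so \<open>R\<close> is
        feasible and \<open>opt\<close> applies to it.\<close>
      obtain R where R: "R \<in> S" "f R \<le> (1 - (- h P / D)) * f P + (- h P / D) * f Q"
          "h R \<le> (1 - (- h P / D)) * h P + (- h P / D) * h Q"
        using conv[OF P(1) 2(1), of "- h P / D"] P(2) 2(2) D by (auto simp: D_def field_simps)
      have "1 - (- h P / D) = h Q / D" using D by (simp add: D_def field_simps)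
      with R have "h R \<le> 0" "f R \<le> (h Q * f P + (- h P) * f Q) / D"
        by (simp_all add: add_divide_distrib mult.commute diff_divide_distrib)
      then have "p \<le> (h Q * f P + (- h P) * f Q) / D" using opt[OF R(1)] by linarith
      then have "p * D \<le> h Q * f P + (- h P) * f Q" using D by (simp add: pos_le_divide_eq)
      then have "(p - f Q) * (- h P) \<le> (f P - p) * h Q" by (simp add: D_def algebra_simps)
      then have "p - f Q \<le> (f P - p) / (- h P) * h Q"
        unfolding times_divide_eq_left using P(2) by (subst pos_le_divide_eq) auto
      then show ?thesis unfolding 2(3) by (rule mult_imp_div_pos_le[OF 2(2)])
    qed
  qed
  have bdd: "bdd_above ?A" using key[OF slater] by (meson bdd_above.I)
  define l where "l = Sup ?A"
  have "0 \<le> l" unfolding l_def using bdd by (intro cSup_upper) auto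
  moreover have "p \<le> f P + l * h P" if P: "P \<in> S" for P
  proof -
    consider "h P = 0" | "h P < 0" | "0 < h P" by linarith
    then show ?thesis
    proof cases
      case 1
      then show ?thesis using opt[OF P] by simp
    next
      case 2
      then have "l \<le> (f P - p) / (- h P)" unfolding l_def using key[OF P] by (intro cSup_least) auto
      then show ?thesis using 2 by (simp add: pos_le_minus_divide_eq field_simps)
    next
      case 3
      then have "(p - f P) / h P \<le> l" unfolding l_def using P bdd by (intro cSup_upper) auto
      then show ?thesis using 3 by (simp add: pos_divide_le_eq)
    qed
  qed
  ultimately show ?thesis by blast
qed

section \<open>Squared distance on the plans and its strict convexity\<close>

definition sq_dist :: "nat \<Rightarrow> (nat \<Rightarrow> nat \<Rightarrow> real) \<Rightarrow> real mat \<Rightarrow> real" where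
  "sq_dist n V P = (\<Sum>i<n. \<Sum>j<n. (P $$ (i, j) - V i j)\<^sup>2)"

lemma frob_norm_sq: "(frob_norm A)\<^sup>2 = (\<Sum>i<dim_row A. \<Sum>j<dim_col A. (A $$ (i, j))\<^sup>2)"
  unfolding frob_norm_def by (intro real_sqrt_pow2 sum_nonneg zero_le_power2)

lemma frob_norm_diff_sq:
  "G \<in> carrier_mat n n \<Longrightarrow> (frob_norm (P - G))\<^sup>2 = sq_dist n (\<lambda>i j. G $$ (i, j)) P"
  unfolding frob_norm_sq sq_dist_def by (intro sum.cong) auto

lemma frob_norm_shift_sq:
  "G \<in> carrier_mat n n \<Longrightarrow> C \<in> carrier_mat n n \<Longrightarrow>
    (frob_norm (P - G + l \<cdot>\<^sub>m C))\<^sup>2 = sq_dist n (\<lambda>i j. G $$ (i, j) - l * C $$ (i, j)) P"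
  unfolding frob_norm_sq sq_dist_def by (intro sum.cong) (auto simp: algebra_simps)

lemma plans_iff:
  assumes "x \<in> carrier_vec n"
  shows "P \<in> plans n x \<longleftrightarrow> P \<in> carrier_mat n n \<and> (\<forall>i<n. \<forall>j<n. 0 \<le> P $$ (i, j)) \<and>
    (\<forall>i<n. (\<Sum>j<n. P $$ (i, j)) = x $ i)"
proof -
  have "P *\<^sub>v ones n = x \<longleftrightarrow> (\<forall>i<n. (\<Sum>j<n. P $$ (i, j)) = x $ i)" if "P \<in> carrier_mat n n"
    using that assms
    by (auto simp: vec_eq_iff ones_def scalar_prod_def lessThan_atLeast0)
  then show ?thesis unfolding plans_def by blast
qed

definition mix :: "nat \<Rightarrow> real \<Rightarrow> real mat \<Rightarrow> real mat \<Rightarrow> real mat" where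
  "mix n t P Q = mat n n (\<lambda>(i, j). (1 - t) * P $$ (i, j) + t * Q $$ (i, j))"

lemma mix_plans:
  assumes "x \<in> carrier_vec n" "P \<in> plans n x" "Q \<in> plans n x" "0 \<le> t" "t \<le> 1"
  shows "mix n t P Q \<in> plans n x"
proof -
  have "(\<Sum>j<n. (1 - t) * P $$ (i, j) + t * Q $$ (i, j)) = x $ i" if "i < n" for i
  proof -
    have "(1 - t) * x $ i + t * x $ i = x $ i" by (simp add: algebra_simps)
    then show ?thesis using assms(1-3) that
      by (simp add: plans_iff sum.distrib flip: sum_distrib_left)
  qed
  moreover have "0 \<le> (1 - t) * P $$ (i, j) + t * Q $$ (i, j)" if "i < n" "j < n" for i j
    using assms that by (intro add_nonneg_nonneg mult_nonneg_nonneg) (auto simp: plans_def)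
  ultimately show ?thesis using assms(1) by (simp add: plans_iff mix_def)
qed

lemma mat_inner_mix:
  assumes "P \<in> carrier_mat n n" "Q \<in> carrier_mat n n"
  shows "mat_inner (mix n t P Q) C = (1 - t) * mat_inner P C + t * mat_inner Q C"
proof -
  have "mat_inner (mix n t P Q) C =
    (\<Sum>i<n. \<Sum>j<n. (1 - t) * (P $$ (i, j) * C $$ (i, j)) + t * (Q $$ (i, j) * C $$ (i, j)))"
    unfolding mat_inner_def by (intro sum.cong) (auto simp: mix_def algebra_simps)
  then show ?thesis using assms by (simp add: mat_inner_def sum.distrib sum_distrib_left)
qed

text \<open>An entrywise polynomial identity. Keeping the exact defect serves twice: its sign gives
  convexity of the objective, its vanishing at \<open>t = 1/2\<close> gives uniqueness.\<close>

lemma sq_dist_mix: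
  "sq_dist n V (mix n t P Q) =
     (1 - t) * sq_dist n V P + t * sq_dist n V Q - t * (1 - t) * sq_dist n (\<lambda>i j. Q $$ (i, j)) P"
proof -
  have "((1 - t) * p + t * q - v)\<^sup>2 = (1 - t) * (p - v)\<^sup>2 + t * (q - v)\<^sup>2 - t * (1 - t) * (p - q)\<^sup>2"
    for p q v by (simp add: power2_eq_square algebra_simps)
  then have "sq_dist n V (mix n t P Q) = (\<Sum>i<n. \<Sum>j<n. (1 - t) * (P $$ (i, j) - V i j)\<^sup>2 +
      t * (Q $$ (i, j) - V i j)\<^sup>2 - t * (1 - t) * (P $$ (i, j) - Q $$ (i, j))\<^sup>2)"
    unfolding sq_dist_def by (intro sum.cong) (auto simp: mix_def)
  then show ?thesis by (simp add: sq_dist_def sum.distrib sum_subtractf sum_distrib_left)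
qed

lemma sq_dist_nonneg: "0 \<le> sq_dist n V P"
  unfolding sq_dist_def by (intro sum_nonneg zero_le_power2)

lemma sq_dist_eq_0:
  assumes "P \<in> carrier_mat n n" "Q \<in> carrier_mat n n" "sq_dist n (\<lambda>i j. Q $$ (i, j)) P = 0"
  shows "P = Q"
  using assms by (intro eq_matI) (auto simp: sq_dist_def sum_nonneg_eq_0_iff sum_nonneg)

text \<open>The midpoint of two minimizers would improve on them by a quarter of their squared
  distance.\<close>

lemma arg_min_sq_dist_unique:
  assumes "x \<in> carrier_vec n" "is_arg_min (sq_dist n V) (\<lambda>P. P \<in> plans n x) P"
    and "is_arg_min (sq_dist n V) (\<lambda>P. P \<in> plans n x) Q"
  shows "P = Q"
proof -
  have P: "P \<in> plans n x" "Q \<in> plans n x" "sq_dist n V P \<le> sq_dist n V Q" "sq_dist n V Q \<le> sq_dist n V P"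
    using assms(2,3) by (auto simp: is_arg_min_linorder)
  have "sq_dist n V P \<le> sq_dist n V (mix n (1/2) P Q)"
    using assms(2) mix_plans[OF assms(1) P(1,2), of "1/2"] by (auto simp: is_arg_min_linorder)
  then have "sq_dist n (\<lambda>i j. Q $$ (i, j)) P \<le> 0" using P(3,4) by (simp add: sq_dist_mix)
  with sq_dist_nonneg[of n "\<lambda>i j. Q $$ (i, j)" P] have "sq_dist n (\<lambda>i j. Q $$ (i, j)) P = 0" by simp
  then show ?thesis using P(1,2) by (intro sq_dist_eq_0) (auto simp: plans_def)
qed

text \<open>Completing the square: the last double sum does not depend on \<open>P\<close>, so
  minimizing the shifted distance is minimizing the Lagrangian.\<close>

lemma sq_dist_shift:
  assumes "P \<in> carrier_mat n n"
  shows "sq_dist n (\<lambda>i j. G i j - l * C $$ (i, j)) P = sq_dist n G P + 2 * l * mat_inner P C +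
    (\<Sum>i<n. \<Sum>j<n. (l * C $$ (i, j))\<^sup>2 - 2 * l * (G i j * C $$ (i, j)))"
proof -
  have "(p - (g - l * c))\<^sup>2 = (p - g)\<^sup>2 + 2 * l * (p * c) + ((l * c)\<^sup>2 - 2 * l * (g * c))" for p g c :: real
    by (simp add: power2_eq_square algebra_simps)
  then have "sq_dist n (\<lambda>i j. G i j - l * C $$ (i, j)) P = (\<Sum>i<n. \<Sum>j<n. (P $$ (i, j) - G i j)\<^sup>2 +
    2 * l * (P $$ (i, j) * C $$ (i, j)) + ((l * C $$ (i, j))\<^sup>2 - 2 * l * (G i j * C $$ (i, j))))"
    unfolding sq_dist_def by (intro sum.cong refl) simp
  then show ?thesis using assms
    by (simp only: sq_dist_def mat_inner_def sum.distrib sum_distrib_left carrier_matD)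
qed

lemma primal_minimizes_lagrangian:
  assumes "problem_data n x G C \<epsilon> \<delta>" "primal_solution n x G C \<delta> Pstar" "dual_solution n x G C \<delta> lstar"
  shows "is_arg_min (sq_dist n (\<lambda>i j. G $$ (i, j) - lstar * C $$ (i, j))) (\<lambda>P. P \<in> plans n x) Pstar"
proof -
  have G: "G \<in> carrier_mat n n" and C: "C \<in> carrier_mat n n" and x: "x \<in> carrier_vec n"
    and x0: "\<And>i. i < n \<Longrightarrow> 0 \<le> x $ i" and \<delta>: "0 < \<delta>"
    and C0: "\<And>i j. i < n \<Longrightarrow> j < n \<Longrightarrow> 0 \<le> C $$ (i, j)" "\<And>i. i < n \<Longrightarrow> C $$ (i, i) = 0"
    using assms(1) unfolding problem_data_def by auto
  define f where "f P = 1/2 * (frob_norm (P - G))\<^sup>2" for P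
  define h where "h P = mat_inner P C - \<delta>" for P
  have f: "f P = 1/2 * sq_dist n (\<lambda>i j. G $$ (i, j)) P" for P
    unfolding f_def frob_norm_diff_sq[OF G] ..
  have carr: "P \<in> carrier_mat n n" if "P \<in> plans n x" for P using that by (simp add: plans_def)
  have dual: "dual_fun n x G C \<delta> l = (INF P\<in>plans n x. f P + l * h P)" for l
    unfolding dual_fun_def f_def h_def ..
  have Ps: "Pstar \<in> plans n x" "h Pstar \<le> 0" and opt: "\<And>P. P \<in> plans n x \<Longrightarrow> h P \<le> 0 \<Longrightarrow> f Pstar \<le> f P"
    using assms(2) unfolding primal_solution_def is_arg_min_linorder f_def h_def by auto
  have l0: "0 \<le> lstar" and lopt: "\<And>l. 0 \<le> l \<Longrightarrow> dual_fun n x G C \<delta> l \<le> dual_fun n x G C \<delta> lstar"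
    using assms(3) unfolding dual_solution_def is_arg_max_linorder by auto
  \<comment> \<open>The Slater point: it is supported on the diagonal, where \<open>C\<close>
    vanishes.\<close>
  let ?D = "mat n n (\<lambda>(i, j). if i = j then x $ i else 0)"
  have D: "?D \<in> plans n x" using x x0 by (auto simp: plans_iff sum.delta' sum.delta)
  have "mat_inner ?D C = 0" unfolding mat_inner_def by (intro sum.neutral ballI) (auto simp: C0)
  then have hD: "h ?D < 0" using \<delta> by (simp add: h_def)
  have "\<exists>l\<ge>0. \<forall>P\<in>plans n x. f Pstar \<le> f P + l * h P"
  proof (rule lagrange_multiplier[where f = f and h = h and ?P0.0 = ?D])
    fix P Q and t :: real
    assume PQ: "P \<in> plans n x" "Q \<in> plans n x" and t: "0 \<le> t" "t \<le> 1"
    have "0 \<le> t * (1 - t) * sq_dist n (\<lambda>i j. Q $$ (i, j)) P"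
      using t by (intro mult_nonneg_nonneg sq_dist_nonneg) auto
    then have "f (mix n t P Q) \<le> (1 - t) * f P + t * f Q" unfolding f sq_dist_mix by (simp add: field_simps)
    moreover have "h (mix n t P Q) \<le> (1 - t) * h P + t * h Q"
      unfolding h_def mat_inner_mix[OF carr[OF PQ(1)] carr[OF PQ(2)]] by (simp add: algebra_simps)
    ultimately show "\<exists>R\<in>plans n x. f R \<le> (1 - t) * f P + t * f Q \<and> h R \<le> (1 - t) * h P + t * h Q"
      using mix_plans[OF x PQ t] by blast
  qed (use D hD opt in auto)
  then obtain l where l: "0 \<le> l" "\<And>P. P \<in> plans n x \<Longrightarrow> f Pstar \<le> f P + l * h P" by blast
  have inner: "0 \<le> mat_inner P C" if "P \<in> plans n x" for P
    unfolding mat_inner_def using that C0 by (intro sum_nonneg mult_nonneg_nonneg) (auto simp: plans_def)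
  \<comment> \<open>A real \<open>INF\<close> is a lower bound only for a family bounded below. Here
    \<open>f P\<close> and \<open>lstar * mat_inner P C\<close> are nonnegative.\<close>
  have lower: "- lstar * \<delta> \<le> f P + lstar * h P" if "P \<in> plans n x" for P
    using mult_nonneg_nonneg[OF l0 inner[OF that]] sq_dist_nonneg[of n "\<lambda>i j. G $$ (i, j)" P]
    by (simp add: f h_def algebra_simps)
  \<comment> \<open>The chain runs through \<open>f Pstar\<close>, the dual value at the Slater
    multiplier \<open>l\<close> and the optimal dual value, which is at most the Lagrangian at any
    plan.\<close>
  have le: "f Pstar + lstar * h Pstar \<le> f P + lstar * h P" if P: "P \<in> plans n x" for P
  proof -
    have "f Pstar + lstar * h Pstar \<le> f Pstar" using Ps(2) l0 by (simp add: mult_nonneg_nonpos)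
    also have "\<dots> \<le> dual_fun n x G C \<delta> l" unfolding dual using D l(2) by (intro cINF_greatest) auto
    also have "\<dots> \<le> dual_fun n x G C \<delta> lstar" by (rule lopt[OF l(1)])
    also have "\<dots> \<le> f P + lstar * h P" unfolding dual using P lower
      by (intro cINF_lower bdd_belowI2[where m = "- lstar * \<delta>"]) auto
    finally show ?thesis .
  qed
  have "sq_dist n (\<lambda>i j. G $$ (i, j) - lstar * C $$ (i, j)) Pstar \<le>
      sq_dist n (\<lambda>i j. G $$ (i, j) - lstar * C $$ (i, j)) P" if "P \<in> plans n x" for P
    using le[OF that] by (simp add: sq_dist_shift carr that Ps(1) f h_def algebra_simps)
  then show ?thesis using Ps(1) by (simp add: is_arg_min_linorder)
qed

section \<open>Projection of a row\<close>

text \<open>\<open>\<tau>\<close> is the multiplier of the sum constraint: in each coordinate the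
  clipped value minimizes \<open>(z - v j)\<^sup>2 + 2 * \<tau> * z\<close> over z \<ge> 0, and the
  linear terms cancel in the sum because both vectors have the same total.\<close>

lemma clip_optimal:
  fixes v z :: "nat \<Rightarrow> real"
  assumes "\<And>j. j < n \<Longrightarrow> 0 \<le> z j" "(\<Sum>j<n. max (v j - \<tau>) 0) = (\<Sum>j<n. z j)"
  shows "(\<Sum>j<n. (max (v j - \<tau>) 0 - v j)\<^sup>2) \<le> (\<Sum>j<n. (z j - v j)\<^sup>2)"
proof -
  have "(max (v j - \<tau>) 0 - v j)\<^sup>2 \<le> (z j - v j)\<^sup>2 + 2 * \<tau> * (z j - max (v j - \<tau>) 0)" if "j < n" for j
  proof (cases "\<tau> \<le> v j")
    case True
    have "0 \<le> (z j - (v j - \<tau>))\<^sup>2" by simp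
    then show ?thesis using True by (simp add: max_def power2_eq_square algebra_simps)
  next
    case False
    have "0 \<le> (z j)\<^sup>2 + 2 * (z j * (\<tau> - v j))" using assms(1)[OF that] False by simp
    then show ?thesis using False by (simp add: max_def power2_eq_square algebra_simps)
  qed
  then have "(\<Sum>j<n. (max (v j - \<tau>) 0 - v j)\<^sup>2) \<le>
      (\<Sum>j<n. (z j - v j)\<^sup>2 + 2 * \<tau> * (z j - max (v j - \<tau>) 0))" by (intro sum_mono) simp
  also have "\<dots> = (\<Sum>j<n. (z j - v j)\<^sup>2)"
    using assms(2) by (simp add: sum.distrib sum_distrib_left[symmetric] sum_subtractf)
  finally show ?thesis .
qed

text \<open>Objective and constraints split over the rows, each of which has its own
  threshold.\<close>

lemma clip_arg_min:
  assumes x: "x \<in> carrier_vec n" and Y: "Y \<in> carrier_mat n n"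
    and row: "\<And>i. i < n \<Longrightarrow> \<exists>\<tau>. (\<Sum>j<n. max (V i j - \<tau>) 0) = x $ i \<and>
      (\<forall>j<n. Y $$ (i, j) = max (V i j - \<tau>) 0)"
  shows "is_arg_min (sq_dist n V) (\<lambda>P. P \<in> plans n x) Y"
proof -
  have "0 \<le> Y $$ (i, j)" if "i < n" "j < n" for i j using row[OF that(1)] that(2) by auto
  moreover have "(\<Sum>j<n. Y $$ (i, j)) = x $ i" if "i < n" for i using row[OF that] by auto
  ultimately have "Y \<in> plans n x" using x Y by (simp add: plans_iff)
  moreover have "sq_dist n V Y \<le> sq_dist n V Z" if Z: "Z \<in> plans n x" for Z
    unfolding sq_dist_def
  proof (rule sum_mono)
    fix i assume "i \<in> {..<n}"
    then have i: "i < n" by simp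
    obtain \<tau> where \<tau>: "(\<Sum>j<n. max (V i j - \<tau>) 0) = x $ i" "\<And>j. j < n \<Longrightarrow> Y $$ (i, j) = max (V i j - \<tau>) 0"
      using row[OF i] by blast
    have "(\<Sum>j<n. (max (V i j - \<tau>) 0 - V i j)\<^sup>2) \<le> (\<Sum>j<n. (Z $$ (i, j) - V i j)\<^sup>2)"
      using Z x i \<tau>(1) by (intro clip_optimal) (auto simp: plans_iff)
    then show "(\<Sum>j<n. (Y $$ (i, j) - V i j)\<^sup>2) \<le> (\<Sum>j<n. (Z $$ (i, j) - V i j)\<^sup>2)" by (simp add: \<tau>(2))
  qed
  ultimately show ?thesis by (simp add: is_arg_min_linorder)
qed

section \<open>Total correctness with time bounds\<close>

text \<open>\<open>t\<close> is an upper bound on the cost, so that branches of different length fit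
  one bound. The existential loses nothing, since \<open>exec\<close> is deterministic.\<close>

definition wp :: "prog \<Rightarrow> nat \<Rightarrow> (machine \<Rightarrow> bool) \<Rightarrow> machine \<Rightarrow> bool" where
  "wp c t Q s \<longleftrightarrow> (\<exists>u s'. exec c s u s' \<and> u \<le> t \<and> Q s')"

inductive_cases exec_SkipE: "exec Skip s t s'"
inductive_cases exec_DoE: "exec (Do i) s t s'"
inductive_cases exec_SeqE: "exec (Seq c d) s t s'"
inductive_cases exec_IfE: "exec (If b c d) s t s'"

lemma exec_Skip_iff: "exec Skip s t s' \<longleftrightarrow> t = 1 \<and> s' = s"
  by (auto elim: exec_SkipE intro: exec.Skip[simplified])

lemma exec_Do_iff: "exec (Do i) s t s' \<longleftrightarrow> t = 1 \<and> step i s = Some s'"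
  by (auto elim: exec_DoE intro: exec.Do[simplified])

lemma exec_Seq_iff:
  "exec (Seq c d) s t s' \<longleftrightarrow> (\<exists>u v r. t = u + v \<and> exec c s u r \<and> exec d r v s')"
  by (auto elim!: exec_SeqE intro: exec.Seq)

lemma exec_If_iff:
  "exec (If b c d) s t s' \<longleftrightarrow> (\<exists>u. t = u + 1 \<and> exec (if holds b s then c else d) s u s')"
  by (auto elim!: exec_IfE intro: exec.IfTrue[simplified] exec.IfFalse[simplified])

lemma wp_mono:
  assumes "wp c t Q s" "t \<le> t'" "\<And>s'. Q s' \<Longrightarrow> Q' s'"
  shows "wp c t' Q' s"
  using assms unfolding wp_def by (meson order_trans)

lemma wp_Skip: "wp Skip t Q s \<longleftrightarrow> 1 \<le> t \<and> Q s"
  by (auto simp: wp_def exec_Skip_iff)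

lemma wp_Do: "wp (Do i) t Q s \<longleftrightarrow> 1 \<le> t \<and> (\<exists>s'. step i s = Some s' \<and> Q s')"
  by (auto simp: wp_def exec_Do_iff)

lemma wp_If:
  "wp (If b c d) t Q s \<longleftrightarrow> 1 \<le> t \<and> (if holds b s then wp c (t - 1) Q s else wp d (t - 1) Q s)"
  by (cases t) (auto simp: wp_def exec_If_iff)

lemma wp_Seq_iff:
  "wp (Seq c d) t Q s \<longleftrightarrow> (\<exists>u r. exec c s u r \<and> u \<le> t \<and> wp d (t - u) Q r)"
proof -
  have "u + v \<le> t \<longleftrightarrow> u \<le> t \<and> v \<le> t - u" for u v by linarith
  then show ?thesis unfolding wp_def exec_Seq_iff by blast
qed

lemma wp_Skip_Seq: "wp (Seq Skip e) t Q s \<longleftrightarrow> 1 \<le> t \<and> wp e (t - 1) Q s"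
  unfolding wp_Seq_iff exec_Skip_iff by blast

lemma wp_Do_Seq:
  "wp (Seq (Do i) e) t Q s \<longleftrightarrow> 1 \<le> t \<and> (\<exists>s'. step i s = Some s' \<and> wp e (t - 1) Q s')"
  unfolding wp_Seq_iff exec_Do_iff by blast

lemma wp_Seq_Seq: "wp (Seq (Seq c d) e) t Q s \<longleftrightarrow> wp (Seq c (Seq d e)) t Q s"
proof -
  have "exec (Seq (Seq c d) e) s u r \<longleftrightarrow> exec (Seq c (Seq d e)) s u r" for u r
    unfolding exec_Seq_iff by (metis add.assoc)
  then show ?thesis unfolding wp_def by blast
qed

lemma wp_If_Seq:
  "wp (Seq (If b c d) e) t Q s \<longleftrightarrow>
     1 \<le> t \<and> (if holds b s then wp (Seq c e) (t - 1) Q s else wp (Seq d e) (t - 1) Q s)"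
proof (cases t)
  case (Suc k)
  then show ?thesis
    by (cases "holds b s"; simp add: wp_Seq_iff exec_If_iff; fastforce)
qed (auto simp: wp_Seq_iff exec_If_iff)

text \<open>Rewriting with these executes loop-free code symbolically from the front, drawing each
  cost from the budget; \<open>wp_Seq_Seq\<close> keeps the next instruction in front. Loops go
  through invariants.\<close>

lemmas wp_simps = wp_Skip wp_Do wp_If wp_Skip_Seq wp_Do_Seq wp_Seq_Seq wp_If_Seq

section \<open>Frame conditions read off the syntax\<close>

fun target :: "cell \<Rightarrow> nat" where
  "target (Cell a r) = a"

fun step_regs :: "instr \<Rightarrow> nat set" where
  "step_regs (ISet r k) = {r}"
| "step_regs (IAdd r p q) = {r}"
| "step_regs (ISub r p q) = {r}"
| "step_regs _ = {}"

fun step_arrs :: "instr \<Rightarrow> nat set" where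
  "step_arrs (RSet d k) = {target d}"
| "step_arrs (RCopy d u) = {target d}"
| "step_arrs (ROp f d u v) = {target d}"
| "step_arrs _ = {}"

fun mod_regs :: "prog \<Rightarrow> nat set" where
  "mod_regs Skip = {}"
| "mod_regs (Do i) = step_regs i"
| "mod_regs (Seq c d) = mod_regs c \<union> mod_regs d"
| "mod_regs (If b c d) = mod_regs c \<union> mod_regs d"
| "mod_regs (While b c) = mod_regs c"

fun mod_arrs :: "prog \<Rightarrow> nat set" where
  "mod_arrs Skip = {}"
| "mod_arrs (Do i) = step_arrs i"
| "mod_arrs (Seq c d) = mod_arrs c \<union> mod_arrs d"
| "mod_arrs (If b c d) = mod_arrs c \<union> mod_arrs d"
| "mod_arrs (While b c) = mod_arrs c"

text \<open>Arrays count as a whole. Loop invariants then need not mention what the loop body never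
  writes.\<close>

definition unchanged :: "prog \<Rightarrow> machine \<Rightarrow> machine \<Rightarrow> bool" where
  "unchanged c s s' \<longleftrightarrow>
     (\<forall>r. r \<notin> mod_regs c \<longrightarrow> reg s' r = reg s r) \<and> (\<forall>a. a \<notin> mod_arrs c \<longrightarrow> arr s' a = arr s a)"

lemma unchanged_reg: "unchanged c s s' \<Longrightarrow> r \<notin> mod_regs c \<Longrightarrow> reg s' r = reg s r"
  by (simp add: unchanged_def)

lemma unchanged_arr: "unchanged c s s' \<Longrightarrow> a \<notin> mod_arrs c \<Longrightarrow> arr s' a = arr s a"
  by (simp add: unchanged_def)

lemma unchanged_refl: "unchanged c s s"
  by (simp add: unchanged_def)

lemma unchanged_trans: "unchanged c s s' \<Longrightarrow> unchanged c s' s'' \<Longrightarrow> unchanged c s s''"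
  by (simp add: unchanged_def)

lemma step_unchanged: "step i s = Some s' \<Longrightarrow> unchanged (Do i) s s'"
proof (cases i)
  case (RSet d k)
  then show "step i s = Some s' \<Longrightarrow> ?thesis" by (cases d) (auto simp: unchanged_def)
next
  case (RCopy d u)
  then show "step i s = Some s' \<Longrightarrow> ?thesis" by (cases d) (auto simp: unchanged_def)
next
  case (ROp f d u v)
  then show "step i s = Some s' \<Longrightarrow> ?thesis" by (cases d) (auto simp: unchanged_def)
qed (auto simp: unchanged_def)

lemma exec_unchanged: "exec c s t s' \<Longrightarrow> unchanged c s s'"
  by (induction rule: exec.induct) (use step_unchanged in \<open>auto simp: unchanged_def\<close>)

lemma wp_frame:
  assumes "wp c t Q s"
  shows "wp c t (\<lambda>s'. Q s' \<and> unchanged c s s') s"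
  using assms unfolding wp_def by (blast dest: exec_unchanged)

lemma wp_Seq:
  assumes "wp c t R s" and "\<And>s'. R s' \<Longrightarrow> unchanged c s s' \<Longrightarrow> wp d u Q s'" and "t + u \<le> v"
  shows "wp (Seq c d) v Q s"
proof -
  obtain k s' where c: "exec c s k s'" "k \<le> t" "R s'" using assms(1) unfolding wp_def by blast
  with assms(2) exec_unchanged obtain l s'' where "exec d s' l s''" "l \<le> u" "Q s''"
    unfolding wp_def by blast
  with c assms(3) show ?thesis unfolding wp_def by (meson add_mono exec.Seq order_trans)
qed

text \<open>The index of the invariant is the variant: at most \<open>d\<close> rounds cost
  \<open>t + 1\<close> each, test included, and one last test fails. The body may assume the frame
  condition relative to the initial state \<open>s\<close>, as it is transitive.\<close>

lemma wp_While:
  assumes "I d s"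
    and body: "\<And>d s'. I d s' \<Longrightarrow> unchanged c s s' \<Longrightarrow> holds b s' \<Longrightarrow> \<exists>d'<d. wp c t (I d') s'"
  shows "wp (While b c) (d * (t + 1) + 1) (\<lambda>s'. (\<exists>d'. I d' s') \<and> \<not> holds b s') s"
proof -
  have "I d s' \<Longrightarrow> unchanged c s s' \<Longrightarrow>
      wp (While b c) (d * (t + 1) + 1) (\<lambda>s'. (\<exists>d'. I d' s') \<and> \<not> holds b s') s'" for s'
  proof (induction d arbitrary: s' rule: less_induct)
    case (less d)
    show ?case
    proof (cases "holds b s'")
      case False
      then show ?thesis unfolding wp_def using less.prems
        by (intro exI[of _ 1] exI[of _ s']) (auto intro: exec.WhileFalse[simplified])
    next
      case True
      from body[OF less.prems True] obtain d' where d': "d' < d" "wp c t (I d') s'" by blast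
      then obtain k r where r: "exec c s' k r" "k \<le> t" "I d' r" unfolding wp_def by blast
      from less.prems(2) r(1) have "unchanged c s r"
        by (blast intro: unchanged_trans dest: exec_unchanged)
      from less.IH[OF d'(1) r(3) this] obtain l q where
        q: "exec (While b c) r l q" "l \<le> d' * (t + 1) + 1" "(\<exists>d'. I d' q) \<and> \<not> holds b q"
        unfolding wp_def by blast
      have "(d' + 1) * (t + 1) \<le> d * (t + 1)" using d'(1) by (intro mult_right_mono) auto
      then have "k + l + 1 \<le> d * (t + 1) + 1" using q(2) r(2) by (simp add: algebra_simps)
      then show ?thesis unfolding wp_def using exec.WhileTrue[OF True r(1) q(1)] q(3) by blast
    qed
  qed
  with assms(1) unchanged_refl show ?thesis by blast
qed

lemma wp_While_post:
  assumes "I d s"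
    and "\<And>d s'. I d s' \<Longrightarrow> unchanged c s s' \<Longrightarrow> holds b s' \<Longrightarrow> \<exists>d'<d. wp c t (I d') s'"
    and post: "\<And>d s'. I d s' \<Longrightarrow> unchanged c s s' \<Longrightarrow> \<not> holds b s' \<Longrightarrow> Q s'"
    and "d * (t + 1) + 1 \<le> u"
  shows "wp (While b c) u Q s"
proof (rule wp_mono[OF wp_frame[OF wp_While[where I = I, OF assms(1,2)]] assms(4)])
  fix s' assume "((\<exists>d'. I d' s') \<and> \<not> holds b s') \<and> unchanged (While b c) s s'"
  then show "Q s'" using post by (auto simp: unchanged_def)
qed

section \<open>Heapsort\<close>

abbreviation (input) seq (infixr ";;" 60) where "c ;; d \<equiv> Seq c d"

abbreviation (input) "rN \<equiv> 0::nat"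
abbreviation (input) "rZero \<equiv> 1::nat"
abbreviation (input) "rOne \<equiv> 2::nat"
abbreviation (input) "rRow \<equiv> 3::nat"
abbreviation (input) "rBase \<equiv> 4::nat"
abbreviation (input) "rCol \<equiv> 5::nat"
abbreviation (input) "rPos \<equiv> 6::nat"
abbreviation (input) "rRoot \<equiv> 7::nat"
abbreviation (input) "rHole \<equiv> 8::nat"
abbreviation (input) "rBound \<equiv> 9::nat"
abbreviation (input) "rTop \<equiv> 10::nat"
abbreviation (input) "rChild \<equiv> 11::nat"
abbreviation (input) "rSibling \<equiv> 12::nat"

abbreviation (input) "aG \<equiv> 0::nat"
abbreviation (input) "aC \<equiv> 1::nat"
abbreviation (input) "aX \<equiv> 2::nat"
abbreviation (input) "aPar \<equiv> 3::nat"
abbreviation (input) "aOut \<equiv> 4::nat"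
abbreviation (input) "aHeap \<equiv> 5::nat"
text \<open>A real scalar is entry \<open>0\<close> of an array of its own, addressed through the
  register that stays \<open>0\<close>. The same register turns \<open>IAdd\<close> into a register
  copy.\<close>

abbreviation (input) "scTmp \<equiv> Cell 6 rZero"
abbreviation (input) "scZero \<equiv> Cell 7 rZero"
abbreviation (input) "scUnit \<equiv> Cell 8 rZero"
abbreviation (input) "scSum \<equiv> Cell 9 rZero"
abbreviation (input) "scCount \<equiv> Cell 10 rZero"
abbreviation (input) "scThr \<equiv> Cell 11 rZero"

section \<open>Sifting down\<close>

definition swap :: "nat \<Rightarrow> nat \<Rightarrow> prog" where
  "swap p q = Do (RCopy scTmp (Cell aHeap p)) ;; Do (RCopy (Cell aHeap p) (Cell aHeap q)) ;;
     Do (RCopy (Cell aHeap q) scTmp)"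

text \<open>
  The machine can double an index but not halve it, so heaps are built and repaired by downward
  moves only.
\<close>

definition pick_child :: prog where
  "pick_child = Do (IAdd rSibling rChild rOne) ;;
     If (ILess rSibling rBound)
       (If (RLess (Cell aHeap rChild) (Cell aHeap rSibling)) (Do (IAdd rChild rSibling rZero)) Skip)
       Skip"

definition push_down :: prog where
  "push_down =
     If (RLess (Cell aHeap rHole) (Cell aHeap rChild))
       (swap rHole rChild ;; Do (IAdd rHole rChild rZero))
       (Do (IAdd rHole rBound rZero)) ;;
     Do (IAdd rChild rHole rHole)"

definition sift :: prog where
  "sift = Do (IAdd rChild rHole rHole) ;; While (ILess rChild rBound) (pick_child ;; push_down)"

text \<open>
  Heaps start at index \<open>1\<close>, the parent of \<open>c\<close> being \<open>c div 2\<close>; \<open>m\<close> is an exclusive upper bound.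
  The second clause of \<open>heap_except\<close> keeps the order between the children and the parent of the
  hole \<open>i\<close>, which is what allows a child to move up. For \<open>i = m\<close> there is no hole left, so this
  position marks the end of sifting.
\<close>

definition heap_except :: "nat \<Rightarrow> nat \<Rightarrow> nat \<Rightarrow> (nat \<Rightarrow> real) \<Rightarrow> bool" where
  "heap_except lo m i h \<longleftrightarrow>
     (\<forall>c<m. lo \<le> c div 2 \<and> c div 2 \<noteq> i \<longrightarrow> h c \<le> h (c div 2)) \<and>
     (\<forall>c<m. c div 2 = i \<and> lo \<le> i div 2 \<longrightarrow> h c \<le> h (i div 2))"

definition heap :: "nat \<Rightarrow> nat \<Rightarrow> (nat \<Rightarrow> real) \<Rightarrow> bool" where
  "heap lo m h \<longleftrightarrow> (\<forall>c<m. lo \<le> c div 2 \<longrightarrow> h c \<le> h (c div 2))"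

lemma heap_except_leaf: "heap_except lo m i h \<Longrightarrow> m \<le> 2 * i \<Longrightarrow> heap lo m h"
  by (auto simp: heap_except_def heap_def)

text \<open>Here \<open>j\<close> is a largest child. No \<open>c < m\<close> has parent
  \<open>m\<close>, so with hole \<open>m\<close> the first clause is the full heap property and the
  second is vacuous.\<close>

lemma heap_except_done:
  assumes "heap_except lo m i h" "\<And>c. c < m \<Longrightarrow> c div 2 = i \<Longrightarrow> h c \<le> h j" "h j \<le> h i"
  shows "heap_except lo m m h"
proof -
  have "h c \<le> h (c div 2)" if "c < m" "lo \<le> c div 2" for c
    using assms(1) assms(2)[of c] assms(3) that unfolding heap_except_def
    by (cases "c div 2 = i") auto
  then show ?thesis by (auto simp: heap_except_def)
qed

text \<open>Moved up, the largest child \<open>j\<close> dominates its sibling and the old entry of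
  \<open>i\<close>; the second clause of \<open>heap_except\<close> keeps it below the parent of
  \<open>i\<close>. The children of \<open>j\<close> were below \<open>h j\<close>, which now sits
  at their grandparent: this is the second clause for the new hole.\<close>

lemma heap_except_swap:
  assumes "heap_except lo m i h" "\<And>c. c < m \<Longrightarrow> c div 2 = i \<Longrightarrow> h c \<le> h j" "h i \<le> h j"
    and "j div 2 = i" "1 \<le> i" "j < m"
  shows "heap_except lo m j (h \<circ> transpose i j)"
proof -
  have 1: "h c \<le> h (c div 2)" if "c < m" "lo \<le> c div 2" "c div 2 \<noteq> i" for c
    using assms(1) that unfolding heap_except_def by blast
  have 2: "h c \<le> h (i div 2)" if "c < m" "c div 2 = i" "lo \<le> i div 2" for c
    using assms(1) that unfolding heap_except_def by blast
  have ij: "i < j" "i div 2 < i" "i < m" using assms(4-6) by auto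
  have "(h \<circ> transpose i j) c \<le> (h \<circ> transpose i j) (c div 2)"
    if "c < m" "lo \<le> c div 2" "c div 2 \<noteq> j" for c
  proof -
    consider "c = i" | "c = j" | "c \<noteq> i" "c \<noteq> j" "c div 2 = i" | "c \<noteq> i" "c \<noteq> j" "c div 2 \<noteq> i"
      by blast
    then show ?thesis
    proof cases
      case 1
      then show ?thesis using 2[of j] assms(4,6) that ij by (simp add: transpose_def)
    next
      case 2
      then show ?thesis using assms(3,4) by (simp add: transpose_def)
    next
      case 3
      then show ?thesis using assms(2)[of c] that by (simp add: transpose_def)
    next
      case 4
      then show ?thesis using 1[of c] that by (simp add: transpose_def)
    qed
  qed
  moreover have "(h \<circ> transpose i j) c \<le> (h \<circ> transpose i j) (j div 2)"
    if "c < m" "c div 2 = j" "lo \<le> j div 2" for c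
    using 1[of c] that assms(4) ij by (auto simp: transpose_def)
  ultimately show ?thesis unfolding heap_except_def by blast
qed

lemma fun_upd_swap: "h(i := h j, j := h i) = h \<circ> transpose i j"
  by (auto simp: fun_eq_iff transpose_def)

text \<open>The hole at least doubles in each round, so the clause with \<open>2 ^ d\<close> bounds
  the remaining rounds by \<open>d\<close>. Confining the permutation to \<open>{lo..<m}\<close>
  protects the part already sorted.\<close>

definition sift_inv :: "nat \<Rightarrow> (nat \<Rightarrow> real) \<Rightarrow> nat \<Rightarrow> nat \<Rightarrow> machine \<Rightarrow> bool" where
  "sift_inv lo h m d s \<longleftrightarrow>
     lo \<le> reg s rHole \<and> m \<le> 2 ^ d * reg s rHole \<and> reg s rChild = 2 * reg s rHole \<and>
     (\<exists>\<pi>. \<pi> permutes {lo..<m} \<and> arr s aHeap = h \<circ> \<pi>) \<and>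
     heap_except lo m (reg s rHole) (arr s aHeap)"

lemma sift_inv_swap:
  assumes "sift_inv lo h m (Suc d) s" "1 \<le> lo" "j < m" "j div 2 = reg s rHole"
    and "\<And>c. c < m \<Longrightarrow> c div 2 = reg s rHole \<Longrightarrow> arr s aHeap c \<le> arr s aHeap j"
    and "arr s aHeap (reg s rHole) < arr s aHeap j"
    and "reg s' rHole = j" "reg s' rChild = 2 * j"
    and "arr s' aHeap = arr s aHeap \<circ> transpose (reg s rHole) j"
  shows "sift_inv lo h m d s'"
proof -
  let ?i = "reg s rHole"
  obtain \<pi> where \<pi>: "\<pi> permutes {lo..<m}" "arr s aHeap = h \<circ> \<pi>"
    using assms(1) unfolding sift_inv_def by blast
  have i: "lo \<le> ?i" "m \<le> 2 ^ d * (2 * ?i)" "heap_except lo m ?i (arr s aHeap)"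
    using assms(1) unfolding sift_inv_def by (auto simp: mult.assoc mult.left_commute)
  have "2 ^ d * (2 * ?i) \<le> 2 ^ d * j" using assms(4) by (intro mult_left_mono) auto
  then have d: "m \<le> 2 ^ d * j" using i by linarith
  have "transpose ?i j permutes {lo..<m}"
    using i(1) assms(3,4) by (intro permutes_swap_id) auto
  then have "\<pi> \<circ> transpose ?i j permutes {lo..<m}" using \<pi>(1) by (intro permutes_compose)
  moreover have "arr s' aHeap = h \<circ> (\<pi> \<circ> transpose ?i j)" using assms(9) \<pi>(2) by (simp add: comp_assoc)
  moreover have "heap_except lo m j (arr s' aHeap)"
    unfolding assms(9) using i assms by (intro heap_except_swap) auto
  moreover have "lo \<le> j" using i(1) assms(4) by auto
  ultimately show ?thesis unfolding sift_inv_def using d assms(7,8) by blast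
qed

text \<open>Any \<open>d'\<close> is possible because m \<le> \<open>2 ^ d' * m\<close>: jumping to
  \<open>m\<close> satisfies the variant clause for every budget.\<close>

lemma sift_inv_stop:
  assumes "sift_inv lo h m d s" "1 \<le> lo" "lo \<le> m"
    and "\<And>c. c < m \<Longrightarrow> c div 2 = reg s rHole \<Longrightarrow> arr s aHeap c \<le> arr s aHeap j"
    and "arr s aHeap j \<le> arr s aHeap (reg s rHole)"
    and "reg s' rHole = m" "reg s' rChild = 2 * m" "arr s' aHeap = arr s aHeap"
  shows "sift_inv lo h m d' s'"
proof -
  have "heap_except lo m m (arr s aHeap)"
    using assms(1,4,5) unfolding sift_inv_def by (blast intro: heap_except_done)
  then show ?thesis using assms unfolding sift_inv_def by simp
qed

lemma pick_child_correct:
  assumes "reg s rZero = 0" "reg s rOne = 1" "reg s rChild = 2 * i" "2 * i < reg s rBound"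
  shows "wp pick_child 4 (\<lambda>s'. reg s' rChild < reg s rBound \<and> reg s' rChild div 2 = i \<and>
    (\<forall>c<reg s rBound. c div 2 = i \<longrightarrow> arr s aHeap c \<le> arr s aHeap (reg s' rChild))) s"
proof -
  have "c div 2 = i \<longleftrightarrow> c = 2 * i \<or> c = Suc (2 * i)" for c by auto
  then show ?thesis using assms by (auto simp: pick_child_def wp_simps)
qed

text \<open>Two states occur because \<open>pick_child\<close> may break the clause
  \<open>reg s rChild = 2 * reg s rHole\<close>; \<open>s'\<close> is the state after it.\<close>

lemma push_down_correct:
  assumes inv: "sift_inv lo h m (Suc d) s" and "1 \<le> lo" "reg s rZero = 0" "reg s rBound = m"
    and s': "reg s' rZero = 0" "reg s' rBound = m" "reg s' rHole = reg s rHole"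
      "arr s' aHeap = arr s aHeap"
    and j: "reg s' rChild < m" "reg s' rChild div 2 = reg s rHole"
      "\<And>c. c < m \<Longrightarrow> c div 2 = reg s rHole \<Longrightarrow> arr s aHeap c \<le> arr s aHeap (reg s' rChild)"
  shows "wp push_down 6 (sift_inv lo h m d) s'"
proof -
  have lo: "lo \<le> reg s rHole" "lo \<le> m" "reg s rHole \<noteq> reg s' rChild"
    using inv j(1,2) assms(2) unfolding sift_inv_def by auto
  show ?thesis
  proof (cases "arr s aHeap (reg s rHole) < arr s aHeap (reg s' rChild)")
    case True
    show ?thesis using True s' lo
      by (simp add: push_down_def swap_def wp_simps)
        (rule sift_inv_swap[OF inv assms(2) j], simp_all add: fun_upd_swap)
  next
    case False
    show ?thesis using False s' lo
      by (simp add: push_down_def swap_def wp_simps)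
        (rule sift_inv_stop[OF inv assms(2) lo(2) j(3)], simp_all)
  qed
qed

lemma sift_body_correct:
  assumes inv: "sift_inv lo h m (Suc d) s" and "1 \<le> lo"
    and r: "reg s rZero = 0" "reg s rOne = 1" "reg s rBound = m" and b: "reg s rChild < m"
  shows "wp (pick_child ;; push_down) 10 (sift_inv lo h m d) s"
proof (rule wp_Seq[where t = 4 and u = 6])
  have c: "reg s rChild = 2 * reg s rHole" using inv unfolding sift_inv_def by blast
  show "wp pick_child 4 (\<lambda>s'. reg s' rChild < m \<and> reg s' rChild div 2 = reg s rHole \<and>
    (\<forall>c<m. c div 2 = reg s rHole \<longrightarrow> arr s aHeap c \<le> arr s aHeap (reg s' rChild))) s"
    using pick_child_correct[OF r(1,2) c] b c r(3) by simp
  fix s'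
  assume s': "reg s' rChild < m \<and> reg s' rChild div 2 = reg s rHole \<and>
    (\<forall>c<m. c div 2 = reg s rHole \<longrightarrow> arr s aHeap c \<le> arr s aHeap (reg s' rChild))"
    and u: "unchanged pick_child s s'"
  show "wp push_down 6 (sift_inv lo h m d) s'"
    by (rule push_down_correct[OF inv assms(2) r(1,3)])
      (use s' r unchanged_reg[OF u] unchanged_arr[OF u] in \<open>auto simp: pick_child_def\<close>)
qed simp

lemma sift_correct:
  assumes "heap_except lo m (reg s rHole) (arr s aHeap)" "lo \<le> reg s rHole" "1 \<le> lo"
    and r: "reg s rZero = 0" "reg s rOne = 1" "reg s rBound = m" and b: "m \<le> 2 ^ d"
  shows "wp sift (11 * d + 2) (\<lambda>s'. heap lo m (arr s' aHeap) \<and>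
    (\<exists>\<pi>. \<pi> permutes {lo..<m} \<and> arr s' aHeap = arr s aHeap \<circ> \<pi>)) s"
proof -
  let ?t = "s\<lparr>reg := (reg s)(rChild := 2 * reg s rHole)\<rparr>"
  have "m \<le> 2 ^ d * reg s rHole"
    using b assms(2,3) mult_le_mono2[of 1 "reg s rHole" "2 ^ d"] by linarith
  then have inv: "sift_inv lo (arr s aHeap) m d ?t"
    unfolding sift_inv_def using assms by (auto intro!: exI[of _ id] permutes_id)
  have "wp (While (ILess rChild rBound) (pick_child ;; push_down)) (11 * d + 1)
    (\<lambda>s'. heap lo m (arr s' aHeap) \<and>
    (\<exists>\<pi>. \<pi> permutes {lo..<m} \<and> arr s' aHeap = arr s aHeap \<circ> \<pi>)) ?t"
  proof (rule wp_While_post[where I = "sift_inv lo (arr s aHeap) m" and t = 10, OF inv])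
    fix d s'
    assume inv: "sift_inv lo (arr s aHeap) m d s'" and u: "unchanged (pick_child ;; push_down) ?t s'"
    have r': "reg s' rZero = 0" "reg s' rOne = 1" "reg s' rBound = m"
      using r unchanged_reg[OF u] by (auto simp: pick_child_def push_down_def swap_def)
    {
      assume "holds (ILess rChild rBound) s'"
      with r' have c: "reg s' rChild < m" by simp
      \<comment> \<open>For \<open>d = 0\<close> the hole is at \<open>m\<close> or beyond, hence so
        is its child.\<close>
      with inv have "d \<noteq> 0" by (intro notI) (auto simp: sift_inv_def)
      then obtain e where "d = Suc e" by (cases d) auto
      with sift_body_correct[of lo _ m e] inv assms(3) r' c
      show "\<exists>d'<d. wp (pick_child ;; push_down) 10 (sift_inv lo (arr s aHeap) m d') s'" by blast
    next
      assume "\<not> holds (ILess rChild rBound) s'"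
      with inv r' show "heap lo m (arr s' aHeap) \<and>
        (\<exists>\<pi>. \<pi> permutes {lo..<m} \<and> arr s' aHeap = arr s aHeap \<circ> \<pi>)"
        unfolding sift_inv_def by (auto intro: heap_except_leaf)
    }
  qed simp
  then show ?thesis by (simp add: sift_def wp_simps mult_2)
qed

section \<open>Building the heap from the last index upwards\<close>

definition build_heap :: prog where
  "build_heap = Do (IAdd rRoot rN rZero) ;; While (ILess rZero rRoot)
     (Do (IAdd rHole rRoot rZero) ;; sift ;; Do (ISub rRoot rRoot rOne))"

lemma mod_regs_sift: "mod_regs sift = {rHole, rChild, rSibling}"
  by (auto simp: sift_def pick_child_def push_down_def swap_def)

lemma mod_arrs_sift: "mod_arrs sift = {aHeap, 6}"
  by (auto simp: sift_def pick_child_def push_down_def swap_def)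

text \<open>Starting at \<open>n\<close> avoids halving it; on a leaf, \<open>sift\<close> stops
  after one test. Each of the \<open>n\<close> rounds is charged a full \<open>sift\<close>, which
  is cheap enough for sorting.\<close>

lemma build_heap_correct:
  assumes r: "reg s rZero = 0" "reg s rOne = 1" "reg s rN = n" "reg s rBound = Suc n"
    and d: "Suc n \<le> 2 ^ d"
  shows "wp build_heap (n * (11 * d + 5) + 2) (\<lambda>s'. heap 1 (Suc n) (arr s' aHeap) \<and>
    (\<exists>\<pi>. \<pi> permutes {1..n} \<and> arr s' aHeap = arr s aHeap \<circ> \<pi>)) s"
proof -
  let ?I = "\<lambda>k s'. reg s' rRoot = k \<and> k \<le> n \<and> heap (Suc k) (Suc n) (arr s' aHeap) \<and>
    (\<exists>\<pi>. \<pi> permutes {1..n} \<and> arr s' aHeap = arr s aHeap \<circ> \<pi>)"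
  let ?body = "Do (IAdd rHole rRoot rZero) ;; sift ;; Do (ISub rRoot rRoot rOne)"
  have "wp (While (ILess rZero rRoot) ?body) (n * (11 * d + 5) + 1) (\<lambda>s'. heap 1 (Suc n) (arr s' aHeap) \<and>
    (\<exists>\<pi>. \<pi> permutes {1..n} \<and> arr s' aHeap = arr s aHeap \<circ> \<pi>))
    (s\<lparr>reg := (reg s)(rRoot := n)\<rparr>)" (is "wp _ _ _ ?s")
  proof (rule wp_While_post[where I = ?I and d = n and t = "11 * d + 4"])
    show "?I n ?s"
      by (auto simp: heap_def intro!: exI[of _ id] permutes_id)
  next
    fix k s'
    assume I: "?I k s'" and u: "unchanged ?body ?s s'" and h: "holds (ILess rZero rRoot) s'"
    have r': "reg s' rZero = 0" "reg s' rOne = 1" "reg s' rBound = Suc n"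
      using unchanged_reg[OF u] r by (auto simp: mod_regs_sift)
    from h r' I obtain l where k: "k = Suc l" by (cases k) auto
    obtain \<pi> where \<pi>: "\<pi> permutes {1..n}" "arr s' aHeap = arr s aHeap \<circ> \<pi>" using I by blast
    let ?t = "s'\<lparr>reg := (reg s')(rHole := k)\<rparr>"
    \<comment> \<open>The parent of \<open>k\<close> lies below the lower bound \<open>k\<close>, so
      the second clause is vacuous.\<close>
    have "heap_except k (Suc n) k (arr s' aHeap)"
      using I k unfolding heap_except_def heap_def by auto
    then have "wp sift (11 * d + 2) (\<lambda>s'. heap k (Suc n) (arr s' aHeap) \<and>
      (\<exists>\<pi>. \<pi> permutes {k..<Suc n} \<and> arr s' aHeap = arr ?t aHeap \<circ> \<pi>)) ?t"
      using r' d k by (intro sift_correct) auto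
    then have "wp (sift ;; Do (ISub rRoot rRoot rOne)) (11 * d + 3) (?I l) ?t"
    proof (rule wp_Seq[where u = 1])
      fix t'
      assume t': "heap k (Suc n) (arr t' aHeap) \<and>
        (\<exists>\<pi>. \<pi> permutes {k..<Suc n} \<and> arr t' aHeap = arr ?t aHeap \<circ> \<pi>)"
        and ut: "unchanged sift ?t t'"
      from t' obtain \<rho> where \<rho>: "\<rho> permutes {k..<Suc n}" "arr t' aHeap = arr s' aHeap \<circ> \<rho>" by auto
      have "\<rho> permutes {1..n}" using \<rho>(1) k by (auto elim!: permutes_subset)
      then have "\<pi> \<circ> \<rho> permutes {1..n}" using \<pi>(1) by (intro permutes_compose)
      moreover have "reg t' rRoot = k" "reg t' rOne = 1"
        using unchanged_reg[OF ut] r' I by (auto simp: mod_regs_sift)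
      ultimately show "wp (Do (ISub rRoot rRoot rOne)) 1 (?I l) t'"
        using t' k I \<rho>(2) \<pi>(2) by (auto simp: wp_simps comp_assoc)
    qed simp
    then have "wp ?body (11 * d + 4) (?I l) s'"
      using I r' by (simp add: wp_simps add.commute)
    then show "\<exists>l<k. wp ?body (11 * d + 4) (?I l) s'" using k by blast
  next
    fix k s'
    assume "?I k s'" and u: "unchanged ?body ?s s'" and "\<not> holds (ILess rZero rRoot) s'"
    moreover have "reg s' rZero = 0" using unchanged_reg[OF u] r by (auto simp: mod_regs_sift)
    ultimately have "?I 0 s'" by auto
    then show "heap 1 (Suc n) (arr s' aHeap) \<and>
      (\<exists>\<pi>. \<pi> permutes {1..n} \<and> arr s' aHeap = arr s aHeap \<circ> \<pi>)" by simp
  qed simp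
  then show ?thesis using r by (simp add: build_heap_def wp_simps)
qed

section \<open>Sorting by repeated removal of the maximum\<close>

lemma heap_root:
  assumes "heap 1 m h" "1 \<le> c" "c < m"
  shows "h c \<le> h 1"
  using assms(2,3)
proof (induction c rule: less_induct)
  case (less c)
  show ?case
  proof (cases "c = 1")
    case False
    then have "1 \<le> c div 2" "c div 2 < c" using less.prems by auto
    moreover from this have "h c \<le> h (c div 2)" using assms(1) less.prems unfolding heap_def by auto
    ultimately show ?thesis using less.IH[of "c div 2"] less.prems by linarith
  qed simp
qed

text \<open>Letting \<open>k\<close> start at \<open>1\<close> expresses both that the entries from
  \<open>m\<close> on ascend and that they dominate the remaining heap.\<close>

definition sorted_above :: "nat \<Rightarrow> nat \<Rightarrow> (nat \<Rightarrow> real) \<Rightarrow> bool" where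
  "sorted_above m n h \<longleftrightarrow> (\<forall>l\<in>{m..n}. \<forall>k\<in>{1..l}. h k \<le> h l)"

text \<open>The swap brings the root, the maximum of the heap, to \<open>m\<close>, and
  \<open>\<pi>\<close> (the later sifting) stays below \<open>m\<close>. Entries beyond
  \<open>m\<close> dominate \<open>{1..m}\<close> in whatever order.\<close>

lemma sorted_above_step:
  assumes "sorted_above (Suc m) n h" "heap 1 (Suc m) h" "\<pi> permutes {1..<m}" "1 \<le> m"
  shows "sorted_above m n (h \<circ> transpose 1 m \<circ> \<pi>)"
proof -
  let ?\<sigma> = "transpose 1 m \<circ> \<pi>"
  have "\<pi> permutes {1..m}" using assms(3) by (rule permutes_subset) auto
  then have \<sigma>: "?\<sigma> permutes {1..m}" using assms(4) by (intro permutes_compose permutes_swap_id) auto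
  have m: "?\<sigma> m = 1" using permutes_not_in[OF assms(3)] by simp
  have "h (?\<sigma> k) \<le> h (?\<sigma> l)" if "m \<le> l" "l \<le> n" "1 \<le> k" "k \<le> l" for k l
  proof (cases "l = m")
    case True
    then have "?\<sigma> k \<in> {1..m}" using that permutes_in_image[OF \<sigma>, of k] by auto
    then show ?thesis using heap_root[OF assms(2)] m True by auto
  next
    case False
    then have l: "?\<sigma> l = l" using permutes_not_in[OF \<sigma>, of l] that by auto
    have "?\<sigma> k \<in> {1..l}"
      using permutes_in_image[OF \<sigma>, of k] permutes_not_in[OF \<sigma>, of k] that by (cases "k \<le> m") auto
    then show ?thesis using assms(1) that l False unfolding sorted_above_def by auto
  qed
  then show ?thesis by (auto simp: sorted_above_def)
qed

text \<open>After the decrement, \<open>rBound\<close> is both the last heap position, to be swapped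
  with the root, and the exclusive bound of the smaller heap.\<close>

definition sort_heap :: prog where
  "sort_heap = While (ILess rOne rBound)
     (Do (ISub rBound rBound rOne) ;; swap rOne rBound ;; Do (IAdd rHole rOne rZero) ;; sift)"

lemma sort_heap_correct:
  assumes r: "reg s rZero = 0" "reg s rOne = 1" "reg s rBound = Suc n"
    and h: "heap 1 (Suc n) (arr s aHeap)" and d: "Suc n \<le> 2 ^ d"
  shows "wp sort_heap (n * (11 * d + 8) + 1) (\<lambda>s'. sorted_above 1 n (arr s' aHeap) \<and>
    (\<exists>\<pi>. \<pi> permutes {1..n} \<and> arr s' aHeap = arr s aHeap \<circ> \<pi>)) s"
proof -
  let ?I = "\<lambda>k s'. reg s' rBound = Suc k \<and> k \<le> n \<and> heap 1 (Suc k) (arr s' aHeap) \<and>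
    sorted_above (Suc k) n (arr s' aHeap) \<and>
    (\<exists>\<pi>. \<pi> permutes {1..n} \<and> arr s' aHeap = arr s aHeap \<circ> \<pi>)"
  let ?body = "Do (ISub rBound rBound rOne) ;; swap rOne rBound ;; Do (IAdd rHole rOne rZero) ;; sift"
  show ?thesis
    unfolding sort_heap_def
  proof (rule wp_While_post[where I = ?I and d = n and t = "11 * d + 7"])
    show "?I n s"
      using r h by (auto simp: sorted_above_def intro!: exI[of _ id] permutes_id)
  next
    fix k s'
    assume I: "?I k s'" and u: "unchanged ?body s s'" and "holds (ILess rOne rBound) s'"
    have r': "reg s' rZero = 0" "reg s' rOne = 1"
      using unchanged_reg[OF u] r by (auto simp: mod_regs_sift swap_def)
    from \<open>holds (ILess rOne rBound) s'\<close> r' I obtain l where k: "k = Suc l" by (cases k) auto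
    obtain \<pi> where \<pi>: "\<pi> permutes {1..n}" "arr s' aHeap = arr s aHeap \<circ> \<pi>" using I by blast
    let ?h = "arr s' aHeap \<circ> transpose 1 k"
    let ?t = "s'\<lparr>arr := (arr s')(6 := (arr s' 6)(0 := arr s' aHeap 1), aHeap := ?h),
      reg := (reg s')(rBound := k, rHole := 1)\<rparr>"
    \<comment> \<open>Below \<open>k\<close> the swap changes only the root, which has no parent in
      range.\<close>
    have "heap_except 1 k 1 ?h"
      using I unfolding heap_except_def heap_def by (auto simp: transpose_def)
    then have "wp sift (11 * d + 2) (\<lambda>s'. heap 1 k (arr s' aHeap) \<and>
      (\<exists>\<pi>. \<pi> permutes {1..<k} \<and> arr s' aHeap = arr ?t aHeap \<circ> \<pi>)) ?t"
      using r' d I by (intro sift_correct) auto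
    from wp_frame[OF this] have "wp sift (11 * d + 2) (?I l) ?t"
    proof (rule wp_mono)
      fix t'
      assume t': "(heap 1 k (arr t' aHeap) \<and>
        (\<exists>\<pi>. \<pi> permutes {1..<k} \<and> arr t' aHeap = arr ?t aHeap \<circ> \<pi>)) \<and> unchanged sift ?t t'"
      then obtain \<rho> where \<rho>: "\<rho> permutes {1..<k}" "arr t' aHeap = ?h \<circ> \<rho>" by auto
      from t' have "reg t' rBound = k" using unchanged_reg[of sift ?t t'] by (auto simp: mod_regs_sift)
      moreover have "sorted_above k n (arr t' aHeap)"
        using I k sorted_above_step[OF _ _ \<rho>(1)] unfolding \<rho>(2) by auto
      moreover have "\<rho> permutes {1..n}" "transpose 1 k permutes {1..n}"
        using \<rho>(1) k I by (auto elim!: permutes_subset intro!: permutes_swap_id)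
      then have "\<pi> \<circ> (transpose 1 k \<circ> \<rho>) permutes {1..n}" using \<pi>(1) by (intro permutes_compose)
      ultimately show "?I l t'"
        using t' k I \<rho>(2) \<pi>(2) by (auto simp: comp_assoc)
    qed simp
    then have "wp ?body (11 * d + 7) (?I l) s'"
      using I r' by (simp add: wp_simps swap_def fun_upd_swap)
    then show "\<exists>l<k. wp ?body (11 * d + 7) (?I l) s'" using k by blast
  next
    fix k s'
    assume "?I k s'" and u: "unchanged ?body s s'" and "\<not> holds (ILess rOne rBound) s'"
    moreover have "reg s' rOne = 1" using unchanged_reg[OF u] r by (auto simp: mod_regs_sift swap_def)
    ultimately have "?I 0 s'" by auto
    then show "sorted_above 1 n (arr s' aHeap) \<and>
      (\<exists>\<pi>. \<pi> permutes {1..n} \<and> arr s' aHeap = arr s aHeap \<circ> \<pi>)" by simp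
  qed simp
qed


section \<open>The projection program\<close>

text \<open>The shift for which the entries from \<open>j\<close> on, each lowered by it, sum to
  \<open>a\<close>. In ascending order these are the \<open>n + 1 - j\<close> largest
  entries.\<close>

definition tail_thr :: "(nat \<Rightarrow> real) \<Rightarrow> real \<Rightarrow> nat \<Rightarrow> nat \<Rightarrow> real" where
  "tail_thr h a n j = (sum h {j..n} - a) / real (n + 1 - j)"

text \<open>
  The largest tail threshold is the right one: with \<open>\<tau>\<close> the threshold of the tail from \<open>j\<close>, that
  tail alone contributes \<open>a\<close>, which gives \<open>\<ge>\<close>; the entries above \<open>\<tau>\<close> form a tail whose threshold is
  at most \<open>\<tau>\<close>, which gives \<open>\<le>\<close>.
\<close>

lemma threshold_sum:
  assumes h: "sorted_above 1 n h" and a: "0 \<le> a"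
    and ub: "\<And>j. j \<in> {1..n} \<Longrightarrow> tail_thr h a n j \<le> \<tau>" and j0: "j \<in> {1..n}" "\<tau> = tail_thr h a n j"
  shows "(\<Sum>k\<in>{1..n}. max (h k - \<tau>) 0) = a"
proof (rule antisym)
  have mean: "(\<Sum>k\<in>{j..n}. h k - \<tau>) = real (n + 1 - j) * (tail_thr h a n j - \<tau>) + a" if "j \<in> {1..n}" for j
  proof -
    have "real (n + 1 - j) * tail_thr h a n j = sum h {j..n} - a" using that by (simp add: tail_thr_def)
    then show ?thesis by (simp add: sum_subtractf right_diff_distrib)
  qed
  have "a = (\<Sum>k\<in>{j..n}. h k - \<tau>)" using mean[OF j0(1)] j0(2) by simp
  also have "\<dots> \<le> (\<Sum>k\<in>{j..n}. max (h k - \<tau>) 0)" by (intro sum_mono) simp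
  also have "\<dots> \<le> (\<Sum>k\<in>{1..n}. max (h k - \<tau>) 0)" using j0(1) by (intro sum_mono2) auto
  finally show "a \<le> (\<Sum>k\<in>{1..n}. max (h k - \<tau>) 0)" .
  show "(\<Sum>k\<in>{1..n}. max (h k - \<tau>) 0) \<le> a"
  proof (cases "\<exists>k\<in>{1..n}. \<tau> < h k")
    \<comment> \<open>Without entries above \<open>\<tau>\<close> there is no tail to compare with;
      here \<open>a \<ge> 0\<close> is what settles the bound.\<close>
    case False
    then have "(\<Sum>k\<in>{1..n}. max (h k - \<tau>) 0) = 0" by (intro sum.neutral) auto
    then show ?thesis using a by simp
  next
    case True
    define m where "m = (LEAST k. k \<in> {1..n} \<and> \<tau> < h k)"
    from True have "\<exists>k. k \<in> {1..n} \<and> \<tau> < h k" by blast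
    from LeastI_ex[OF this, folded m_def] have m: "m \<in> {1..n}" "\<tau> < h m" by simp_all
    have lt: "h k \<le> \<tau>" if "k \<in> {1..n}" "k < m" for k
      using not_less_Least[of k "\<lambda>k. k \<in> {1..n} \<and> \<tau> < h k"] that unfolding m_def by auto
    have gt: "\<tau> < h k" if "k \<in> {m..n}" for k
      using h m that unfolding sorted_above_def by force
    have "(\<Sum>k\<in>{1..n}. max (h k - \<tau>) 0) = (\<Sum>k\<in>{m..n}. max (h k - \<tau>) 0)"
      using m(1) by (intro sum.mono_neutral_right ballI) (use lt in \<open>auto simp: max_absorb2\<close>)
    also have "\<dots> = (\<Sum>k\<in>{m..n}. h k - \<tau>)"
      by (intro sum.cong refl max_absorb1) (use gt in \<open>simp add: less_imp_le\<close>)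
    also have "\<dots> \<le> a" using mean[OF m(1)] ub[OF m(1)] by (simp add: mult_nonneg_nonpos)
    finally show ?thesis .
  qed
qed

text \<open>\<open>scThr\<close> starts with the tail threshold at \<open>n\<close>, so it is
  attained at every moment. \<open>scSum\<close> starts at \<open>- a\<close>, and the count is kept
  as a real because index registers cannot enter a division.\<close>

definition scan :: prog where
  "scan = Do (ROp Sub scSum scZero (Cell aX rRow)) ;; Do (RCopy scCount scZero) ;;
     Do (ROp Sub scThr (Cell aHeap rN) (Cell aX rRow)) ;; Do (IAdd rCol rN rZero) ;;
     While (ILess rZero rCol)
       (Do (ROp Add scSum scSum (Cell aHeap rCol)) ;; Do (ROp Add scCount scCount scUnit) ;;
        Do (ROp Div scTmp scSum scCount) ;;
        If (RLess scThr scTmp) (Do (RCopy scThr scTmp)) Skip ;;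
        Do (ISub rCol rCol rOne))"

lemma scan_correct:
  assumes r: "reg s rZero = 0" "reg s rOne = 1" "reg s rN = n" "1 \<le> n"
    and sc: "arr s 7 0 = 0" "arr s 8 0 = 1"
    and a: "arr s aX (reg s rRow) = a" "0 \<le> a" and h: "sorted_above 1 n (arr s aHeap)"
  shows "wp scan (n * 7 + 5) (\<lambda>s'. (\<Sum>k\<in>{1..n}. max (arr s aHeap k - arr s' 11 0) 0) = a) s"
proof -
  let ?h = "arr s aHeap"
  let ?I = "\<lambda>k s'. reg s' rCol = k \<and> k \<le> n \<and> arr s' 9 0 = sum ?h {Suc k..n} - a \<and>
    arr s' 10 0 = real (n - k) \<and> (\<forall>j\<in>{Suc k..n}. tail_thr ?h a n j \<le> arr s' 11 0) \<and>
    (\<exists>j\<in>{1..n}. arr s' 11 0 = tail_thr ?h a n j)"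
  let ?body = "Do (ROp Add scSum scSum (Cell aHeap rCol)) ;; Do (ROp Add scCount scCount scUnit) ;;
        Do (ROp Div scTmp scSum scCount) ;;
        If (RLess scThr scTmp) (Do (RCopy scThr scTmp)) Skip ;;
        Do (ISub rCol rCol rOne)"
  let ?s = "s\<lparr>arr := (arr s)(9 := (arr s 9)(0 := - a), 10 := (arr s 10)(0 := 0),
      11 := (arr s 11)(0 := ?h n - a)), reg := (reg s)(rCol := n)\<rparr>"
  have "wp (While (ILess rZero rCol) ?body) (n * 7 + 1)
    (\<lambda>s'. (\<Sum>k\<in>{1..n}. max (?h k - arr s' 11 0) 0) = a) ?s"
  proof (rule wp_While_post[where I = ?I and d = n and t = 6])
    show "?I n ?s" using r(4) by (auto simp: tail_thr_def intro!: bexI[of _ n])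
  next
    fix k s'
    assume I: "?I k s'" and u: "unchanged ?body ?s s'" and h: "holds (ILess rZero rCol) s'"
    have r': "reg s' rZero = 0" "reg s' rOne = 1" "arr s' 8 0 = 1" "arr s' aHeap = ?h"
      using unchanged_reg[OF u] unchanged_arr[OF u] r sc by auto
    from h r' I obtain l where k: "k = Suc l" by (cases k) auto
    have kn: "Suc l \<le> n" using I k by simp
    have sm: "sum ?h {Suc l..n} = ?h (Suc l) + sum ?h {Suc (Suc l)..n}"
      using kn by (rule sum.atLeast_Suc_atMost)
    have cn: "real (n - Suc l) + 1 = real (n - l)" using kn by (simp add: of_nat_diff)
    have mn: "tail_thr ?h a n (Suc l) = (sum ?h {Suc (Suc l)..n} - a + ?h (Suc l)) / (real (n - Suc l) + 1)"
      unfolding tail_thr_def sm cn by (simp add: algebra_simps)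
    have rng: "j \<in> {Suc l..n} \<longleftrightarrow> j = Suc l \<or> j \<in> {Suc (Suc l)..n}" for j using kn by auto
    \<comment> \<open>Division by \<open>0\<close> would leave the machine stuck; the divisor counts
      the current entry already.\<close>
    have nz: "real (n - Suc l) + 1 \<noteq> 0" by (metis of_nat_Suc add.commute of_nat_eq_0_iff nat.distinct(2))
    let ?q = "(sum ?h {Suc (Suc l)..n} - a + ?h (Suc l)) / (real (n - Suc l) + 1)"
    have "wp ?body 6 (?I l) s'"
    proof (cases "arr s' 11 0 < ?q")
      case True
      have "tail_thr ?h a n j \<le> ?q" if "j \<in> {Suc l..n}" for j
        using that I True unfolding rng mn[symmetric] k by fastforce
      moreover have "\<exists>j\<in>{1..n}. ?q = tail_thr ?h a n j" using mn kn by (intro bexI[of _ "Suc l"]) auto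
      ultimately show ?thesis
        using True I k r' nz sm cn by (simp add: wp_simps)
    next
      case False
      have "tail_thr ?h a n j \<le> arr s' 11 0" if "j \<in> {Suc l..n}" for j
        using that I False unfolding rng mn[symmetric] k by auto
      then show ?thesis
        using False I k r' nz sm cn by (simp add: wp_simps)
    qed
    then show "\<exists>l<k. wp ?body 6 (?I l) s'" using k by blast
  next
    fix k s'
    assume I: "?I k s'" and u: "unchanged ?body ?s s'" and "\<not> holds (ILess rZero rCol) s'"
    moreover have "reg s' rZero = 0" using unchanged_reg[OF u] r by auto
    ultimately have k: "k = 0" by simp
    from I obtain j where "j \<in> {1..n}" "arr s' 11 0 = tail_thr ?h a n j" by blast
    then show "(\<Sum>k\<in>{1..n}. max (?h k - arr s' 11 0) 0) = a"
      using I k h a(2) by (intro threshold_sum[where j = j]) auto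
  qed simp
  then show ?thesis using r sc a by (simp add: scan_def wp_simps)
qed

text \<open>The row is stored twice: \<open>aHeap\<close> gets sorted, from index \<open>1\<close>
  on, while \<open>aOut\<close> keeps the column order for \<open>clip\<close>, so no permutation
  has to be undone. \<open>Cell aPar rOne\<close> holds \<open>\<lambda>\<close>.\<close>

definition fill :: prog where
  "fill = Do (IAdd rPos rBase rZero) ;; Do (IAdd rCol rOne rZero) ;;
     While (ILess rCol rTop)
       (Do (ROp Mul scTmp (Cell aPar rOne) (Cell aC rPos)) ;;
        Do (ROp Sub (Cell aOut rPos) (Cell aG rPos) scTmp) ;;
        Do (RCopy (Cell aHeap rCol) (Cell aOut rPos)) ;;
        Do (IAdd rCol rCol rOne) ;; Do (IAdd rPos rPos rOne))"

lemma fill_correct: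
  assumes r: "reg s rZero = 0" "reg s rOne = 1" "reg s rTop = Suc n" "reg s rBase = b"
    and v: "\<And>j. j < n \<Longrightarrow> v j = arr s aG (b + j) - arr s aPar 1 * arr s aC (b + j)"
  shows "wp fill (n * 6 + 3) (\<lambda>s'.
    arr s' aOut = (\<lambda>q. if q \<in> {b..<b + n} then v (q - b) else arr s aOut q) \<and>
    (\<forall>j<n. arr s' aHeap (Suc j) = v j)) s"
proof -
  \<comment> \<open>The variant \<open>d\<close> is the number of columns left, since
    \<open>rCol\<close> itself increases.\<close>
  let ?I = "\<lambda>d s'. d \<le> n \<and> reg s' rCol = Suc (n - d) \<and> reg s' rPos = b + (n - d) \<and>
    arr s' aOut = (\<lambda>q. if q \<in> {b..<b + (n - d)} then v (q - b) else arr s aOut q) \<and>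
    (\<forall>j<n - d. arr s' aHeap (Suc j) = v j)"
  let ?body = "Do (ROp Mul scTmp (Cell aPar rOne) (Cell aC rPos)) ;;
        Do (ROp Sub (Cell aOut rPos) (Cell aG rPos) scTmp) ;;
        Do (RCopy (Cell aHeap rCol) (Cell aOut rPos)) ;;
        Do (IAdd rCol rCol rOne) ;; Do (IAdd rPos rPos rOne)"
  let ?s = "s\<lparr>reg := (reg s)(rPos := b, rCol := 1)\<rparr>"
  have "wp (While (ILess rCol rTop) ?body) (n * 6 + 1) (\<lambda>s'.
    arr s' aOut = (\<lambda>q. if q \<in> {b..<b + n} then v (q - b) else arr s aOut q) \<and>
    (\<forall>j<n. arr s' aHeap (Suc j) = v j)) ?s"
  proof (rule wp_While_post[where I = ?I and d = n and t = 5])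
    show "?I n ?s" by auto
  next
    fix d s'
    assume I: "?I d s'" and u: "unchanged ?body ?s s'" and "holds (ILess rCol rTop) s'"
    have r': "reg s' rZero = 0" "reg s' rOne = 1" "reg s' rTop = Suc n"
      "arr s' aPar = arr s aPar" "arr s' aC = arr s aC" "arr s' aG = arr s aG"
      using unchanged_reg[OF u] unchanged_arr[OF u] r by auto
    with \<open>holds (ILess rCol rTop) s'\<close> I obtain e where d: "d = Suc e" by (cases d) auto
    define k where "k = n - d"
    have k: "n - e = Suc k" "k < n" "e \<le> n" using I d by (auto simp: k_def)
    have "wp ?body 5 (?I e) s'"
      using I r' k v[OF k(2)]
      unfolding k_def[symmetric] k(1)
      by (auto simp: wp_simps less_Suc_eq fun_eq_iff)
    then show "\<exists>e<d. wp ?body 5 (?I e) s'" using d by blast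
  next
    fix d s'
    assume I: "?I d s'" and u: "unchanged ?body ?s s'" and "\<not> holds (ILess rCol rTop) s'"
    moreover have "reg s' rTop = Suc n" using unchanged_reg[OF u] r by auto
    ultimately have "n - d = n" by simp
    with I show "arr s' aOut = (\<lambda>q. if q \<in> {b..<b + n} then v (q - b) else arr s aOut q) \<and>
    (\<forall>j<n. arr s' aHeap (Suc j) = v j)" by auto
  qed simp
  then show ?thesis using r by (simp add: fill_def wp_simps)
qed

definition clip :: prog where
  "clip = Do (IAdd rPos rBase rZero) ;; Do (ISet rCol 0) ;;
     While (ILess rCol rN)
       (Do (ROp Sub (Cell aOut rPos) (Cell aOut rPos) scThr) ;;
        If (RLess (Cell aOut rPos) scZero) (Do (RCopy (Cell aOut rPos) scZero)) Skip ;;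
        Do (IAdd rCol rCol rOne) ;; Do (IAdd rPos rPos rOne))"

lemma clip_correct:
  assumes r: "reg s rZero = 0" "reg s rOne = 1" "reg s rN = n" "reg s rBase = b"
    and sc: "arr s 7 0 = 0" "arr s 11 0 = \<tau>"
  shows "wp clip (n * 6 + 3) (\<lambda>s'.
    arr s' aOut = (\<lambda>q. if q \<in> {b..<b + n} then max (arr s aOut q - \<tau>) 0 else arr s aOut q)) s"
proof -
  let ?I = "\<lambda>d s'. d \<le> n \<and> reg s' rCol = n - d \<and> reg s' rPos = b + (n - d) \<and>
    arr s' aOut = (\<lambda>q. if q \<in> {b..<b + (n - d)} then max (arr s aOut q - \<tau>) 0 else arr s aOut q)"
  let ?body = "Do (ROp Sub (Cell aOut rPos) (Cell aOut rPos) scThr) ;;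
        If (RLess (Cell aOut rPos) scZero) (Do (RCopy (Cell aOut rPos) scZero)) Skip ;;
        Do (IAdd rCol rCol rOne) ;; Do (IAdd rPos rPos rOne)"
  let ?s = "s\<lparr>reg := (reg s)(rPos := b, rCol := 0)\<rparr>"
  have "wp (While (ILess rCol rN) ?body) (n * 6 + 1) (\<lambda>s'.
    arr s' aOut = (\<lambda>q. if q \<in> {b..<b + n} then max (arr s aOut q - \<tau>) 0 else arr s aOut q)) ?s"
  proof (rule wp_While_post[where I = ?I and d = n and t = 5])
    show "?I n ?s" by auto
  next
    fix d s'
    assume I: "?I d s'" and u: "unchanged ?body ?s s'" and "holds (ILess rCol rN) s'"
    have r': "reg s' rZero = 0" "reg s' rOne = 1" "reg s' rN = n" "arr s' 7 0 = 0" "arr s' 11 0 = \<tau>"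
      using unchanged_reg[OF u] unchanged_arr[OF u] r sc by auto
    with \<open>holds (ILess rCol rN) s'\<close> I obtain e where d: "d = Suc e" by (cases d) auto
    define k where "k = n - d"
    have k: "n - e = Suc k" "k < n" "e \<le> n" using I d by (auto simp: k_def)
    have "wp ?body 5 (?I e) s'"
      using I r' k
      unfolding k_def[symmetric] k(1)
      by (auto simp: wp_simps less_Suc_eq fun_eq_iff max_def)
    then show "\<exists>e<d. wp ?body 5 (?I e) s'" using d by blast
  next
    fix d s'
    assume I: "?I d s'" and u: "unchanged ?body ?s s'" and "\<not> holds (ILess rCol rN) s'"
    moreover have "reg s' rN = n" using unchanged_reg[OF u] r by auto
    ultimately have "n - d = n" by simp
    with I show "arr s' aOut = (\<lambda>q. if q \<in> {b..<b + n} then max (arr s aOut q - \<tau>) 0 else arr s aOut q)"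
      by auto
  qed simp
  then show ?thesis using r by (simp add: clip_def wp_simps)
qed

section \<open>Projecting one row\<close>

definition project_row :: prog where
  "project_row = fill ;; Do (IAdd rBound rTop rZero) ;; build_heap ;; sort_heap ;; scan ;; clip ;;
     Do (IAdd rRow rRow rOne) ;; Do (IAdd rBase rBase rN)"

text \<open>\<open>rBase\<close> follows \<open>i * n\<close> by additions, as there is no index
  multiplication.\<close>

definition ready :: "nat \<Rightarrow> nat \<Rightarrow> machine \<Rightarrow> bool" where
  "ready n i s \<longleftrightarrow> reg s rN = n \<and> reg s rZero = 0 \<and> reg s rOne = 1 \<and> reg s rTop = Suc n \<and>
     reg s rRow = i \<and> reg s rBase = i * n \<and> arr s 7 0 = 0 \<and> arr s 8 0 = 1"

lemma ready_unchanged: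
  assumes "ready n i s" "unchanged c s s'"
    and "mod_regs c \<inter> {rN, rZero, rOne, rTop, rRow, rBase} = {}" "mod_arrs c \<inter> {7, 8} = {}"
  shows "ready n i s'"
  using assms by (auto simp: ready_def unchanged_def)

lemmas mod_simps = fill_def build_heap_def sort_heap_def scan_def clip_def swap_def mod_regs_sift mod_arrs_sift

text \<open>The factor of \<open>n\<close> adds up \<open>6\<close> for \<open>fill\<close>,
  \<open>11 * d + 5\<close> and \<open>11 * d + 8\<close> for the two heap phases, \<open>7\<close>
  for \<open>scan\<close> and \<open>6\<close> for \<open>clip\<close>.\<close>

lemma project_row_correct:
  assumes s: "ready n i s" and n: "1 \<le> n" "Suc n \<le> 2 ^ d" and a: "0 \<le> arr s aX i"
    and v: "\<And>j. j < n \<Longrightarrow> v j = arr s aG (i * n + j) - arr s aPar 1 * arr s aC (i * n + j)"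
  shows "wp project_row (n * (22 * d + 32) + 17) (\<lambda>s'. ready n (Suc i) s' \<and>
    (\<exists>\<tau>. (\<Sum>j<n. max (v j - \<tau>) 0) = arr s aX i \<and> arr s' aOut =
      (\<lambda>q. if q \<in> {i * n..<i * n + n} then max (v (q - i * n) - \<tau>) 0 else arr s aOut q))) s"
    (is "wp _ _ ?Q s")
  unfolding project_row_def
proof (rule wp_Seq[OF fill_correct[where n = n and b = "i * n" and v = v]])
  show "reg s rZero = 0" "reg s rOne = 1" "reg s rTop = Suc n" "reg s rBase = i * n"
    using s by (auto simp: ready_def)
  fix s1
  assume s1: "arr s1 aOut = (\<lambda>q. if q \<in> {i * n..<i * n + n} then v (q - i * n) else arr s aOut q) \<and>
    (\<forall>j<n. arr s1 aHeap (Suc j) = v j)" and u: "unchanged fill s s1"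
  let ?h = "arr s1 aHeap"
  have r1: "ready n i s1" by (rule ready_unchanged[OF s u]) (auto simp: mod_simps)
  have x1: "arr s1 aX = arr s aX" using unchanged_arr[OF u] by (auto simp: mod_simps)
  let ?t = "s1\<lparr>reg := (reg s1)(rBound := Suc n)\<rparr>"
  have t: "ready n i ?t" using r1 by (simp add: ready_def)
  have "wp (build_heap ;; sort_heap ;; scan ;; clip ;; Do (IAdd rRow rRow rOne) ;; Do (IAdd rBase rBase rN))
     (n * (22 * d + 26) + 13) ?Q ?t"
  proof (rule wp_Seq[OF build_heap_correct[where n = n and d = d]])
    show "reg ?t rZero = 0" "reg ?t rOne = 1" "reg ?t rN = n" "reg ?t rBound = Suc n" "Suc n \<le> 2 ^ d"
      using t n by (auto simp: ready_def)
    fix s2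
    assume s2: "heap 1 (Suc n) (arr s2 aHeap) \<and>
      (\<exists>\<pi>. \<pi> permutes {1..n} \<and> arr s2 aHeap = arr ?t aHeap \<circ> \<pi>)" and u: "unchanged build_heap ?t s2"
    have r2: "ready n i s2" by (rule ready_unchanged[OF t u]) (auto simp: mod_simps)
    have x2: "arr s2 aX = arr s aX" "arr s2 aOut = arr s1 aOut" "reg s2 rBound = Suc n"
      using unchanged_arr[OF u] unchanged_reg[OF u] x1 by (auto simp: mod_simps)
    show "wp (sort_heap ;; scan ;; clip ;; Do (IAdd rRow rRow rOne) ;; Do (IAdd rBase rBase rN))
      (n * (11 * d + 21) + 11) ?Q s2"
    proof (rule wp_Seq[OF sort_heap_correct[where n = n and d = d]])
      show "reg s2 rZero = 0" "reg s2 rOne = 1" "reg s2 rBound = Suc n" "Suc n \<le> 2 ^ d"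
        "heap 1 (Suc n) (arr s2 aHeap)"
        using r2 n x2 s2 by (auto simp: ready_def)
      fix s3
      assume s3: "sorted_above 1 n (arr s3 aHeap) \<and>
        (\<exists>\<pi>. \<pi> permutes {1..n} \<and> arr s3 aHeap = arr s2 aHeap \<circ> \<pi>)" and u: "unchanged sort_heap s2 s3"
      have r3: "ready n i s3" by (rule ready_unchanged[OF r2 u]) (auto simp: mod_simps)
      have x3: "arr s3 aX = arr s aX" "arr s3 aOut = arr s1 aOut"
        using unchanged_arr[OF u] x2 by (auto simp: mod_simps)
      show "wp (scan ;; clip ;; Do (IAdd rRow rRow rOne) ;; Do (IAdd rBase rBase rN))
        (n * 13 + 10) ?Q s3"
      proof (rule wp_Seq[OF scan_correct[where n = n and a = "arr s aX i"]])
        show "reg s3 rZero = 0" "reg s3 rOne = 1" "reg s3 rN = n" "1 \<le> n" "arr s3 7 0 = 0"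
          "arr s3 8 0 = 1" "arr s3 aX (reg s3 rRow) = arr s aX i" "0 \<le> arr s aX i"
          "sorted_above 1 n (arr s3 aHeap)"
          using r3 n x3 s3 a by (auto simp: ready_def)
        fix s4
        assume s4: "(\<Sum>k\<in>{1..n}. max (arr s3 aHeap k - arr s4 11 0) 0) = arr s aX i"
          and u: "unchanged scan s3 s4"
        let ?\<tau> = "arr s4 11 0"
        obtain \<pi> \<rho> where p: "\<pi> permutes {1..n}" "arr s2 aHeap = ?h \<circ> \<pi>"
          "\<rho> permutes {1..n}" "arr s3 aHeap = arr s2 aHeap \<circ> \<rho>" using s2 s3 by auto
        have p': "\<pi> \<circ> \<rho> permutes {1..n}" using p by (intro permutes_compose)
        \<comment> \<open>The clipped sum is invariant under permutations, so the threshold of the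
          sorted copy is right for the row itself.\<close>
        have "(\<Sum>j<n. max (v j - ?\<tau>) 0) = (\<Sum>j<n. max (?h (Suc j) - ?\<tau>) 0)"
          using s1 by (intro sum.cong) auto
        also have "\<dots> = (\<Sum>k\<in>{1..n}. max (?h k - ?\<tau>) 0)"
          by (rule sum.reindex_bij_witness[of _ "\<lambda>k. k - 1" Suc]) auto
        also have "\<dots> = (\<Sum>k\<in>{1..n}. max (?h ((\<pi> \<circ> \<rho>) k) - ?\<tau>) 0)"
          by (subst sum.permute[OF p']) (simp add: comp_def)
        also have "\<dots> = arr s aX i" using s4 p by simp
        finally have sum: "(\<Sum>j<n. max (v j - ?\<tau>) 0) = arr s aX i" .
        have r4: "ready n i s4" by (rule ready_unchanged[OF r3 u]) (auto simp: mod_simps)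
        have x4: "arr s4 aOut = arr s1 aOut" using unchanged_arr[OF u] x3 by (auto simp: mod_simps)
        show "wp (clip ;; Do (IAdd rRow rRow rOne) ;; Do (IAdd rBase rBase rN)) (n * 6 + 5) ?Q s4"
        proof (rule wp_Seq[OF clip_correct[where n = n and b = "i * n" and \<tau> = ?\<tau>], where u = 2])
          show "reg s4 rZero = 0" "reg s4 rOne = 1" "reg s4 rN = n" "reg s4 rBase = i * n" "arr s4 7 0 = 0"
            using r4 by (auto simp: ready_def)
          fix s5
          assume s5: "arr s5 aOut =
              (\<lambda>q. if q \<in> {i * n..<i * n + n} then max (arr s4 aOut q - ?\<tau>) 0 else arr s4 aOut q)"
            and u: "unchanged clip s4 s5"
          have r5: "ready n i s5" by (rule ready_unchanged[OF r4 u]) (auto simp: mod_simps)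
          have "arr s5 aOut =
              (\<lambda>q. if q \<in> {i * n..<i * n + n} then max (v (q - i * n) - ?\<tau>) 0 else arr s aOut q)"
            unfolding s5 x4 using s1 by auto
          then show "wp (Do (IAdd rRow rRow rOne) ;; Do (IAdd rBase rBase rN)) 2 ?Q s5"
            using r5 sum by (auto simp: wp_simps ready_def)
        qed simp_all
      qed simp
    qed (simp add: algebra_simps)
  qed (simp add: algebra_simps)
  then show "wp (Do (IAdd rBound rTop rZero) ;; build_heap ;; sort_heap ;; scan ;; clip ;;
      Do (IAdd rRow rRow rOne) ;; Do (IAdd rBase rBase rN)) (n * (22 * d + 26) + 14) ?Q s1"
    using r1 by (simp add: wp_Do_Seq ready_def add.commute)
qed (use v in \<open>simp_all add: algebra_simps\<close>)

section \<open>All rows and the total cost\<close>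

definition project_rows :: prog where
  "project_rows = Do (ISet rOne 1) ;; Do (IAdd rTop rN rOne) ;; Do (RSet scUnit 1) ;;
     While (ILess rRow rN) project_row"

text \<open>Everything outside the input starts at \<open>0\<close>, so three assignments reach
  \<open>ready\<close>; with the last loop test they make up the \<open>4\<close>.\<close>

lemma project_rows_correct:
  fixes n :: nat and G C :: "real mat" and l :: real
  defines "v i j \<equiv> G $$ (i, j) - l * C $$ (i, j)"
  assumes n: "1 \<le> n" "Suc n \<le> 2 ^ d" and x: "\<And>i. i < n \<Longrightarrow> 0 \<le> x $ i"
  shows "wp project_rows (n * (n * (22 * d + 32) + 18) + 4) (\<lambda>s. \<forall>i<n. \<exists>\<tau>.
    (\<Sum>j<n. max (v i j - \<tau>) 0) = x $ i \<and> (\<forall>j<n. arr s aOut (i * n + j) = max (v i j - \<tau>) 0))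
    (load n x G C \<epsilon> l)"
    (is "wp _ _ (\<lambda>s. \<forall>i<n. ?R s i) ?l")
proof -
  let ?I = "\<lambda>e s. e \<le> n \<and> ready n (n - e) s \<and> (\<forall>i<n - e. ?R s i)"
  let ?s = "?l\<lparr>arr := (arr ?l)(8 := (arr ?l 8)(0 := 1)), reg := (reg ?l)(rOne := 1, rTop := Suc n)\<rparr>"
  have "wp (While (ILess rRow rN) project_row) (n * (n * (22 * d + 32) + 18) + 1) (\<lambda>s. \<forall>i<n. ?R s i) ?s"
  proof (rule wp_While_post[where I = ?I and d = n and t = "n * (22 * d + 32) + 17"])
    show "?I n ?s" by (simp add: ready_def load_def)
  next
    fix e s
    assume I: "?I e s" and u: "unchanged project_row ?s s" and h: "holds (ILess rRow rN) s"
    then obtain k where e: "e = Suc k" by (cases e) (auto simp: ready_def)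
    define i where "i = n - e"
    have i: "i < n" "n - k = Suc i" "k \<le> n" using I e by (auto simp: i_def)
    have in_eq: "i * n + j < n * n" "(i * n + j) div n = i" "(i * n + j) mod n = j" if "j < n" for j
      using that i(1) mult_le_mono1[of "Suc i" n n] by (auto simp: add.commute)
    have inp: "arr s aG = arr ?l aG" "arr s aC = arr ?l aC" "arr s aX = arr ?l aX"
      "arr s aPar = arr ?l aPar"
      using unchanged_arr[OF u] by (auto simp: project_row_def mod_simps)
    have xi: "arr s aX i = x $ i" using i by (simp add: inp load_def)
    have "wp project_row (n * (22 * d + 32) + 17) (\<lambda>s'. ready n (Suc i) s' \<and>
      (\<exists>\<tau>. (\<Sum>j<n. max (v i j - \<tau>) 0) = arr s aX i \<and> arr s' aOut =
        (\<lambda>q. if q \<in> {i * n..<i * n + n} then max (v i (q - i * n) - \<tau>) 0 else arr s aOut q))) s"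
      using I n x[OF i(1)] in_eq
      by (intro project_row_correct) (auto simp: xi i_def[symmetric] inp[unfolded One_nat_def] v_def load_def)
    then have "wp project_row (n * (22 * d + 32) + 17) (?I k) s"
    proof (rule wp_mono)
      fix s'
      assume s': "ready n (Suc i) s' \<and>
        (\<exists>\<tau>. (\<Sum>j<n. max (v i j - \<tau>) 0) = arr s aX i \<and> arr s' aOut =
          (\<lambda>q. if q \<in> {i * n..<i * n + n} then max (v i (q - i * n) - \<tau>) 0 else arr s aOut q))"
      have "?R s' r" if "r < Suc i" for r
      proof (cases "r = i")
        case True
        then show ?thesis using s' xi by auto
      next
        case False
        with that have "r < i" by simp
        \<comment> \<open>Row \<open>r\<close> ends before position \<open>i * n\<close>, where the
          writes of this round begin.\<close>
        with mult_le_mono1[of "Suc r" i n] have "r * n + n \<le> i * n" by simp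
        then have "arr s' aOut (r * n + j) = arr s aOut (r * n + j)" if "j < n" for j
          using s' that by auto
        then show ?thesis using I \<open>r < i\<close> by (simp add: i_def[symmetric])
      qed
      then show "?I k s'" using s' i by simp
    qed simp
    then show "\<exists>k<e. wp project_row (n * (22 * d + 32) + 17) (?I k) s" using e by blast
  next
    fix e s
    assume "?I e s" "\<not> holds (ILess rRow rN) s"
    moreover from this have "n - e = n" by (auto simp: ready_def)
    ultimately show "\<forall>i<n. ?R s i" by simp
  qed simp
  then show ?thesis by (simp add: project_rows_def wp_Do_Seq load_def fun_upd_twist)
qed

text \<open>Removing the ceiling costs at most \<open>1\<close> and leaves a real expression to
  compare. The bound is asymptotic: at \<open>n = 1\<close> the right-hand side is
  \<open>0\<close>.\<close>

lemma cost_bigo: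
  defines "d \<equiv> \<lambda>n::nat. nat \<lceil>log 2 (real n + 1)\<rceil>"
  shows "(\<lambda>n. real (n * (n * (22 * d n + 32) + 18) + 4)) \<in> O(\<lambda>n. real n ^ 2 * ln (real n))"
proof -
  have d: "real (d n) \<le> log 2 (real n + 1) + 1" for n
    using ceiling_correct[of "log 2 (real n + 1)"] by (simp add: d_def of_nat_nat)
  let ?b = "\<lambda>n. real n * (real n * (22 * (log 2 (real n + 1) + 1) + 32) + 18) + 4"
  have "real (n * (n * (22 * d n + 32) + 18) + 4) \<le> ?b n" for n
  proof -
    have "real n * (22 * real (d n) + 32) + 18 \<le> real n * (22 * (log 2 (real n + 1) + 1) + 32) + 18"
      using d[of n] by (intro add_right_mono mult_left_mono) auto
    from mult_left_mono[OF this, of "real n"] show ?thesis by simp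
  qed
  then have "(\<lambda>n. real (n * (n * (22 * d n + 32) + 18) + 4)) \<in> O(?b)"
    by (intro landau_o.big_mono always_eventually allI) (smt (verit) real_norm_def of_nat_0_le_iff)
  also have "?b \<in> O(\<lambda>n. real n ^ 2 * ln (real n))"
    by real_asymp
  finally show ?thesis .
qed

lemma le_two_power_ceiling_log: "Suc n \<le> 2 ^ nat \<lceil>log 2 (real n + 1)\<rceil>"
proof -
  have "real n + 1 = 2 powr log 2 (real n + 1)" by (simp add: powr_log_cancel)
  also have "\<dots> \<le> 2 powr real (nat \<lceil>log 2 (real n + 1)\<rceil>)" by (intro powr_mono) linarith+
  also have "\<dots> = real (2 ^ nat \<lceil>log 2 (real n + 1)\<rceil>)" by (subst powr_realpow) simp_all
  finally show ?thesis by linarith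
qed

theorem proposition3:
  shows "(\<forall>n x G C \<epsilon> \<delta> Pstar lstar.
            problem_data n x G C \<epsilon> \<delta> \<and> primal_solution n x G C \<delta> Pstar \<and> dual_solution n x G C \<delta> lstar \<longrightarrow>
            {P. is_arg_min (\<lambda>P. (frob_norm (P - G + lstar \<cdot>\<^sub>m C))\<^sup>2) (\<lambda>P. P \<in> plans n x) P} = {Pstar}) \<and>
         (\<exists>(c :: prog) (T :: nat \<Rightarrow> nat).
            (\<lambda>n. real (T n)) \<in> O(\<lambda>n. real n ^ 2 * ln (real n)) \<and>
            (\<forall>n x G C \<epsilon> \<delta> Pstar lstar.
               problem_data n x G C \<epsilon> \<delta> \<and> primal_solution n x G C \<delta> Pstar \<and> dual_solution n x G C \<delta> lstar \<longrightarrow>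
               (\<exists>t s. exec c (load n x G C \<epsilon> lstar) t s \<and> t \<le> T n \<and> result n s = Pstar)))"
proof (intro conjI)
  let ?data = "\<lambda>n x G C \<epsilon> \<delta> Pstar lstar.
    problem_data n x G C \<epsilon> \<delta> \<and> primal_solution n x G C \<delta> Pstar \<and> dual_solution n x G C \<delta> lstar"
  \<comment> \<open>Serves both claims: it fixes the set of minimizers and identifies the output of
    the program.\<close>
  have unique: "P = Pstar" if "?data n x G C \<epsilon> \<delta> Pstar lstar"
    and "is_arg_min (sq_dist n (\<lambda>i j. G $$ (i, j) - lstar * C $$ (i, j))) (\<lambda>P. P \<in> plans n x) P"
    for n x G C \<epsilon> \<delta> Pstar lstar P
  proof (rule arg_min_sq_dist_unique[OF _ that(2)])
    show "x \<in> carrier_vec n" using that(1) by (simp add: problem_data_def)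
    show "is_arg_min (sq_dist n (\<lambda>i j. G $$ (i, j) - lstar * C $$ (i, j))) (\<lambda>P. P \<in> plans n x) Pstar"
      using that(1) by (blast intro: primal_minimizes_lagrangian)
  qed
  show "\<forall>n x G C \<epsilon> \<delta> Pstar lstar. ?data n x G C \<epsilon> \<delta> Pstar lstar \<longrightarrow>
    {P. is_arg_min (\<lambda>P. (frob_norm (P - G + lstar \<cdot>\<^sub>m C))\<^sup>2) (\<lambda>P. P \<in> plans n x) P} = {Pstar}"
  proof (intro allI impI)
    fix n x G C \<epsilon> \<delta> Pstar lstar
    assume d: "?data n x G C \<epsilon> \<delta> Pstar lstar"
    then have "G \<in> carrier_mat n n" "C \<in> carrier_mat n n" by (simp_all add: problem_data_def)
    then have "(\<lambda>P. (frob_norm (P - G + lstar \<cdot>\<^sub>m C))\<^sup>2) =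
        sq_dist n (\<lambda>i j. G $$ (i, j) - lstar * C $$ (i, j))"
      by (simp add: frob_norm_shift_sq fun_eq_iff)
    then show "{P. is_arg_min (\<lambda>P. (frob_norm (P - G + lstar \<cdot>\<^sub>m C))\<^sup>2) (\<lambda>P. P \<in> plans n x) P} = {Pstar}"
      using unique[OF d] primal_minimizes_lagrangian d by auto
  qed
  let ?d = "\<lambda>n::nat. nat \<lceil>log 2 (real n + 1)\<rceil>"
  let ?T = "\<lambda>n. n * (n * (22 * ?d n + 32) + 18) + 4"
  have "\<exists>t s. exec project_rows (load n x G C \<epsilon> lstar) t s \<and> t \<le> ?T n \<and> result n s = Pstar"
    if d: "?data n x G C \<epsilon> \<delta> Pstar lstar" for n x G C \<epsilon> \<delta> Pstar lstar
  proof -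
    from d have x: "1 \<le> n" "x \<in> carrier_vec n" "\<And>i. i < n \<Longrightarrow> 0 \<le> x $ i"
      by (auto simp: problem_data_def)
    obtain t s where s: "exec project_rows (load n x G C \<epsilon> lstar) t s" "t \<le> ?T n"
      "\<forall>i<n. \<exists>\<tau>. (\<Sum>j<n. max (G $$ (i, j) - lstar * C $$ (i, j) - \<tau>) 0) = x $ i \<and>
        (\<forall>j<n. arr s aOut (i * n + j) = max (G $$ (i, j) - lstar * C $$ (i, j) - \<tau>) 0)"
      using project_rows_correct[OF x(1) le_two_power_ceiling_log x(3)] unfolding wp_def by blast
    \<comment> \<open>The output is recognized by its optimality, without any formula for
      \<open>Pstar\<close>.\<close>
    have "is_arg_min (sq_dist n (\<lambda>i j. G $$ (i, j) - lstar * C $$ (i, j))) (\<lambda>P. P \<in> plans n x) (result n s)"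
      using s(3) by (intro clip_arg_min x(2)) (auto simp: result_def)
    with d have "result n s = Pstar" by (rule unique)
    with s show ?thesis by blast
  qed
  then show "\<exists>(c :: prog) (T :: nat \<Rightarrow> nat).
    (\<lambda>n. real (T n)) \<in> O(\<lambda>n. real n ^ 2 * ln (real n)) \<and>
    (\<forall>n x G C \<epsilon> \<delta> Pstar lstar. ?data n x G C \<epsilon> \<delta> Pstar lstar \<longrightarrow>
       (\<exists>t s. exec c (load n x G C \<epsilon> lstar) t s \<and> t \<le> T n \<and> result n s = Pstar))"
    by (intro exI[of _ project_rows] exI[of _ ?T] conjI cost_bigo allI impI)
qed

end
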